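(* Suppose that $f$ is $L_f$-smooth and $\mu_f$-strongly convex, that $\|A\|\le L_A$, and that the minimum singular value of $A$ is no smaller than $\mu_A>0$. Let $(x^\star,\lambda^\star)$ be the pair of optimal primal and dual variables, let $\{(x_k,\lambda_k)\}$ be the iterate sequence generated by the Inexact PPA algorithm (described in the context), and assume that its regularization parameter satisfies $\ell\ge\mu_\Phi:=\mu_A^2/L_f$ and that $$D_\star:=\|x_0-x^\star\|+\frac{L_A}{L_f}\|\lambda_0-\lambda^\star\|\le D .$$ Then, in order to find an approximate solution $x_T$ satisfying $\mathrm{SubOpt}_{\mathsf{SC}}(x_T):=\|x_T-x^\star\|^2\le\epsilon$, the total number of gradient evaluations for the Inexact PPA algorithm is bounded by $$\tilde O\left(\kappa_A\sqrt{\kappa_f}\,\log(D/\epsilon)\right).$$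
   Context: Problem: $\min_{x\in\mathbb{R}^n}F(x):=f(x)+h(Ax-b)$, where $f:\mathbb{R}^n\to\mathbb{R}$ is differentiable with $L_f$-Lipschitz gradient, $h:\mathbb{R}^m\to\mathbb{R}\cup\{+\infty\}$ is proper closed convex with efficiently computable proximal operator, and $A\in\mathbb{R}^{m\times n}$ has full row rank. Put $\kappa_f=L_f/\mu_f$ and $\kappa_A=L_A/\mu_A$. Here $h^\star(\lambda)=\sup_z\{z^{\mathrm T}\lambda-h(z)\}$ is the conjugate function (similarly $f^\star$) and $\mathrm{prox}_g(x)=\arg\min_u\{g(u)+\frac12\|x-u\|^2\}$. The dual problem is $\max_\lambda\Phi(\lambda):=-f^\star(-A^{\mathrm T}\lambda)-b^{\mathrm T}\lambda-h^\star(\lambda)$; $x^\star$ minimizes $F$ and $\lambda^\star$ maximizes $\Phi$. Subroutine $\mathrm{AGD}(\Psi,y_0,\delta)$ for an $L$-smooth, $\mu$-strongly convex $\Psi$: let $\kappa=L/\mu$, $\theta=\frac{\sqrt\kappa-1}{\sqrt\kappa+1}$, $y_{-1}=y_0$; for $k=0,1,\dots$ set $\tilde y_{k+1}=y_k+\theta(y_k-y_{k-1})$, $y_{k+1}=\tilde y_{k+1}-\frac1L\nabla\Psi(\tilde y_{k+1})$; stop when the current iterate $y_T$ satisfies $\|\nabla\Psi(y_T)\|\le\mu\delta$ and output it. Inexact PPA algorithm. Input: $x_0,\lambda_0$, $L_f$, $\mu_f$, $\mu_A$, regularization parameter $\ell\ge\mu_\Phi$, radius $D>0$. Let $\rho=\frac{\mu_\Phi}{12\ell}$,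 $\delta_k=(1-\rho)^{k/2}D$. For $k=1,\dots,T$: with $$\Psi_k(x)=f(x)+\max_\lambda\left\{\lambda^{\mathrm T}(Ax-b)-h^\star(\lambda)-\tfrac{\ell}{2}\|\lambda-\lambda_{k-1}\|^2\right\}$$ (which is $(L_f+L_A^2/\ell)$-smooth and $\mu_f$-strongly convex), set $x_k=\mathrm{AGD}(\Psi_k,x_{k-1},\delta_k)$ and $\lambda_k=\mathrm{prox}_{h^\star/\ell}\left(\lambda_{k-1}+\frac{Ax_k-b}{\ell}\right)$. Output $x_T$. "Number of gradient evaluations" is the total number of evaluations of $\nabla f$; each evaluation of $\nabla\Psi_k$ costs one evaluation of $\nabla f$. $\tilde O$ hides universal constants and logarithmic factors in the problem parameters.
   Formalization: The bound is proved with an extra factor ℓ/μ_Φ for every ℓ ≥ μ_Φ; without it the claim fails for large ℓ (e.g. f(x)=x²/2, A=1, h the indicator of {0}, where about ℓ evaluations are needed). For ℓ = O(μ_Φ) it is the printed bound. *)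

theory Defs
  imports "HOL-Analysis.Analysis"
begin

section \<open>Convex analysis\<close>

definition grad :: "('a::real_inner \<Rightarrow> real) \<Rightarrow> 'a \<Rightarrow> 'a" where
  "grad f x = (THE g. GDERIV f x :> g)"

definition smooth_fun :: "real \<Rightarrow> ('a::real_inner \<Rightarrow> real) \<Rightarrow> bool" where
  "smooth_fun L f \<longleftrightarrow> (\<forall>x. \<exists>g. GDERIV f x :> g) \<and> L-lipschitz_on UNIV (grad f)"

definition strongly_convex :: "real \<Rightarrow> ('a::real_inner \<Rightarrow> real) \<Rightarrow> bool" where
  "strongly_convex \<mu> f \<longleftrightarrow> convex_on UNIV (\<lambda>x. f x - \<mu> / 2 * (norm x)\<^sup>2)"

text \<open>Extended-valued convexity and closedness (lower semicontinuity) are read off the epigraph.\<close>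

definition epigraph :: "('a \<Rightarrow> ereal) \<Rightarrow> ('a \<times> real) set" where
  "epigraph g = {(z, t). g z \<le> ereal t}"

definition proper_closed_convex :: "('a::real_inner \<Rightarrow> ereal) \<Rightarrow> bool" where
  "proper_closed_convex g \<longleftrightarrow>
     (\<forall>z. g z \<noteq> -\<infinity>) \<and> (\<exists>z. g z \<noteq> \<infinity>) \<and> closed (epigraph g) \<and> convex (epigraph g)"

definition conjugate :: "('a::real_inner \<Rightarrow> ereal) \<Rightarrow> 'a \<Rightarrow> ereal" where
  "conjugate g y = (SUP z. ereal (z \<bullet> y) - g z)"

definition prox :: "('a::real_inner \<Rightarrow> ereal) \<Rightarrow> 'a \<Rightarrow> 'a" where
  "prox g x = arg_min (\<lambda>u. g u + ereal ((norm (x - u))\<^sup>2 / 2)) (\<lambda>_. True)"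

text \<open>The singular values are taken as the square roots of the eigenvalues of \<open>A A\<^sup>T\<close>. For a matrix
  with at most as many rows as columns, in particular one of full row rank, these are all of them.
  The set is finite and nonempty, so that \<open>Inf\<close> is a minimum.\<close>

definition singular_values :: "real^'n^'m \<Rightarrow> real set" where
  "singular_values A =
     {\<sigma>. 0 \<le> \<sigma> \<and> (\<exists>v. v \<noteq> 0 \<and> (A ** transpose A) *v v = \<sigma>\<^sup>2 *\<^sub>R v)}"

definition min_singular_value :: "real^'n^'m \<Rightarrow> real" where
  "min_singular_value A = Inf (singular_values A)"


section \<open>Accelerated gradient descent\<close>

text \<open>\<open>agd_pair \<Psi> L \<mu> y\<^sub>0 k\<close> is the pair of iterates \<open>(y\<^sub>k, y\<^sub>k\<^sub>-\<^sub>1)\<close>, with \<open>y\<^sub>-\<^sub>1 = y\<^sub>0\<close>.\<close>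

primrec agd_pair :: "('a::real_inner \<Rightarrow> real) \<Rightarrow> real \<Rightarrow> real \<Rightarrow> 'a \<Rightarrow> nat \<Rightarrow> 'a \<times> 'a" where
  "agd_pair \<Psi> L \<mu> y0 0 = (y0, y0)"
| "agd_pair \<Psi> L \<mu> y0 (Suc k) =
     (let (y, y') = agd_pair \<Psi> L \<mu> y0 k;
          \<theta> = (sqrt (L / \<mu>) - 1) / (sqrt (L / \<mu>) + 1);
          z = y + \<theta> *\<^sub>R (y - y')
      in (z - (1 / L) *\<^sub>R grad \<Psi> z, y))"

definition agd_iter :: "('a::real_inner \<Rightarrow> real) \<Rightarrow> real \<Rightarrow> real \<Rightarrow> 'a \<Rightarrow> nat \<Rightarrow> 'a" where
  "agd_iter \<Psi> L \<mu> y0 k = fst (agd_pair \<Psi> L \<mu> y0 k)"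

definition agd_stop ::
    "('a::real_inner \<Rightarrow> real) \<Rightarrow> real \<Rightarrow> real \<Rightarrow> 'a \<Rightarrow> real \<Rightarrow> nat \<Rightarrow> bool" where
  "agd_stop \<Psi> L \<mu> y0 \<delta> t \<longleftrightarrow> norm (grad \<Psi> (agd_iter \<Psi> L \<mu> y0 t)) \<le> \<mu> * \<delta>"

text \<open>The step count, the output and the cost below are meaningful only if the call halts.\<close>

definition agd_halts ::
    "('a::real_inner \<Rightarrow> real) \<Rightarrow> real \<Rightarrow> real \<Rightarrow> 'a \<Rightarrow> real \<Rightarrow> bool" where
  "agd_halts \<Psi> L \<mu> y0 \<delta> \<longleftrightarrow> (\<exists>t. agd_stop \<Psi> L \<mu> y0 \<delta> t)"

definition agd_steps ::
    "('a::real_inner \<Rightarrow> real) \<Rightarrow> real \<Rightarrow> real \<Rightarrow> 'a \<Rightarrow> real \<Rightarrow> nat" where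
  "agd_steps \<Psi> L \<mu> y0 \<delta> = (LEAST t. agd_stop \<Psi> L \<mu> y0 \<delta> t)"

definition agd_out ::
    "('a::real_inner \<Rightarrow> real) \<Rightarrow> real \<Rightarrow> real \<Rightarrow> 'a \<Rightarrow> real \<Rightarrow> 'a" where
  "agd_out \<Psi> L \<mu> y0 \<delta> = agd_iter \<Psi> L \<mu> y0 (agd_steps \<Psi> L \<mu> y0 \<delta>)"

text \<open>A call that stops after \<open>t\<close> steps evaluates the gradient at the \<open>t\<close> extrapolated points and, for
  the stopping test, at the iterates \<open>y\<^sub>0, \<dots>, y\<^sub>t\<close>.\<close>

definition agd_grad_evals ::
    "('a::real_inner \<Rightarrow> real) \<Rightarrow> real \<Rightarrow> real \<Rightarrow> 'a \<Rightarrow> real \<Rightarrow> nat" where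
  "agd_grad_evals \<Psi> L \<mu> y0 \<delta> = 2 * agd_steps \<Psi> L \<mu> y0 \<delta> + 1"


section \<open>The composite problem, its dual, and the inexact proximal point algorithm\<close>

definition primal_obj ::
    "(real^'n \<Rightarrow> real) \<Rightarrow> (real^'m \<Rightarrow> ereal) \<Rightarrow> real^'n^'m \<Rightarrow> real^'m \<Rightarrow> real^'n \<Rightarrow> ereal" where
  "primal_obj f h A b x = ereal (f x) + h (A *v x - b)"

definition dual_obj ::
    "(real^'n \<Rightarrow> real) \<Rightarrow> (real^'m \<Rightarrow> ereal) \<Rightarrow> real^'n^'m \<Rightarrow> real^'m \<Rightarrow> real^'m \<Rightarrow> ereal" where
  "dual_obj f h A b lam =
     - conjugate (\<lambda>x. ereal (f x)) (- (transpose A *v lam)) - ereal (b \<bullet> lam) - conjugate h lam"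

definition mu_Phi :: "real \<Rightarrow> real \<Rightarrow> real" where
  "mu_Phi Lf \<mu>A = \<mu>A\<^sup>2 / Lf"

context
  fixes f :: "real^'n \<Rightarrow> real" and h :: "real^'m \<Rightarrow> ereal"
    and A :: "real^'n^'m" and b :: "real^'m"
    and Lf \<mu>f LA \<mu>A ell D :: real
begin

definition ppa_rho :: real where
  "ppa_rho = mu_Phi Lf \<mu>A / (12 * ell)"

definition ppa_delta :: "nat \<Rightarrow> real" where
  "ppa_delta k = (1 - ppa_rho) powr (real k / 2) * D"

text \<open>For proper closed convex \<open>h\<close> and \<open>ell > 0\<close> the supremum is finite and attained.\<close>

definition ppa_Psi :: "real^'m \<Rightarrow> real^'n \<Rightarrow> real" where
  "ppa_Psi lam' x = f x + real_of_ereal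
     (SUP lam. ereal (lam \<bullet> (A *v x - b)) - conjugate h lam - ereal (ell / 2 * (norm (lam - lam'))\<^sup>2))"

definition ppa_L :: real where
  "ppa_L = Lf + LA\<^sup>2 / ell"

primrec ppa :: "real^'n \<Rightarrow> real^'m \<Rightarrow> nat \<Rightarrow> (real^'n) \<times> (real^'m)" where
  "ppa x0 lam0 0 = (x0, lam0)"
| "ppa x0 lam0 (Suc k) =
     (let (x', lam') = ppa x0 lam0 k;
          x = agd_out (ppa_Psi lam') ppa_L \<mu>f x' (ppa_delta (Suc k));
          lam = prox (\<lambda>u. conjugate h u / ereal ell) (lam' + (1 / ell) *\<^sub>R (A *v x - b))
      in (x, lam))"

definition ppa_x :: "real^'n \<Rightarrow> real^'m \<Rightarrow> nat \<Rightarrow> real^'n" where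
  "ppa_x x0 lam0 k = fst (ppa x0 lam0 k)"

definition ppa_lam :: "real^'n \<Rightarrow> real^'m \<Rightarrow> nat \<Rightarrow> real^'m" where
  "ppa_lam x0 lam0 k = snd (ppa x0 lam0 k)"

definition ppa_halts :: "real^'n \<Rightarrow> real^'m \<Rightarrow> nat \<Rightarrow> bool" where
  "ppa_halts x0 lam0 T \<longleftrightarrow> (\<forall>k\<in>{1..T}.
     agd_halts (ppa_Psi (ppa_lam x0 lam0 (k - 1))) ppa_L \<mu>f (ppa_x x0 lam0 (k - 1)) (ppa_delta k))"

definition ppa_grad_evals :: "real^'n \<Rightarrow> real^'m \<Rightarrow> nat \<Rightarrow> nat" where
  "ppa_grad_evals x0 lam0 T = (\<Sum>k=1..T.
     agd_grad_evals (ppa_Psi (ppa_lam x0 lam0 (k - 1))) ppa_L \<mu>f (ppa_x x0 lam0 (k - 1)) (ppa_delta k))"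

end

definition subopt_SC :: "'a::real_normed_vector \<Rightarrow> 'a \<Rightarrow> real" where
  "subopt_SC xstar x = (norm (x - xstar))\<^sup>2"

text \<open>Soft-O bounds. A quantity is bounded by the main term \<open>B\<close> up to a universal constant and
  logarithmic factors in the problem parameters, here through their sum \<open>P \<ge> 0\<close>. Type variables
  cannot be quantified inside a formula, so an existentially quantified constant could depend on the
  dimensions; numerals are used instead, which makes the constant the same for all of them.\<close>

definition soft_O :: "real \<Rightarrow> real \<Rightarrow> real" where
  "soft_O P B = 10 ^ 5 * (ln (2 + P))\<^sup>2 * B"

end

theory Submission
  imports Defs
begin

text \<open>The outer iteration is an inexact proximal point method on the dual. The dual function is
  \<open>\<mu>\<^sub>\<Phi>\<close>-strongly concave, so an exact step contracts \<open>\<parallel>\<lambda> - \<lambda>\<^sup>\<star>\<parallel>\<close> by \<open>1 / (1 + q)\<close> with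
  \<open>q = \<mu>\<^sub>\<Phi> / \<ell>\<close>, while the inner accuracies only decay like \<open>s\<^sup>k\<close> with \<open>s = sqrt (1 - q / 12)\<close>. Hence
  \<open>\<parallel>\<lambda>\<^sub>k - \<lambda>\<^sup>\<star>\<parallel> = O(s\<^sup>k)\<close>, and \<open>\<parallel>x\<^sub>k - x\<^sup>\<star>\<parallel> = O(s\<^sup>k)\<close> since \<open>\<nabla>f(x)\<close> determines \<open>x\<close> in a Lipschitz way; this
  gives about \<open>log(D / \<epsilon>) / q\<close> outer steps. Each inner problem starts within a factor polynomial in the
  condition numbers of its target accuracy, and its condition number is at most
  \<open>2 \<kappa>\<^sub>A\<^sup>2 \<kappa>\<^sub>f\<close>, so Nesterov's Lyapunov function bounds the inner steps by
  \<open>\<kappa>\<^sub>A sqrt \<kappa>\<^sub>f\<close> up to a logarithm. In the dual, everything is expressed by subgradients of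
  \<open>h\<^sup>\<star>\<close>; strong duality comes from full row rank.\<close>

section \<open>Gradients of smooth and convex functions\<close>

lemma grad_eq:
  assumes "GDERIV f x :> g"
  shows "grad f x = g"
  unfolding grad_def
proof (rule the_equality)
  show "GDERIV f x :> g" by fact
next
  fix g' assume "GDERIV f x :> g'"
  then have "(\<lambda>h. h \<bullet> g') = (\<lambda>h. h \<bullet> g)"
    using assms has_derivative_unique unfolding gderiv_def by blast
  then have "(g' - g) \<bullet> g' = (g' - g) \<bullet> g" by metis
  then have "(g' - g) \<bullet> (g' - g) = 0" by (simp add: inner_diff_right)
  then show "g' = g" by simp
qed

lemma smooth_fun_gderiv: "smooth_fun L f \<Longrightarrow> GDERIV f x :> grad f x"
  unfolding smooth_fun_def using grad_eq by metis

lemma smooth_fun_lipschitz: "smooth_fun L f \<Longrightarrow> norm (grad f x - grad f y) \<le> L * norm (x - y)"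
  unfolding smooth_fun_def lipschitz_on_def by (simp add: dist_norm)

lemma gderiv_line:
  assumes "GDERIV f (x + t *\<^sub>R d) :> g"
  shows "((\<lambda>t. f (x + t *\<^sub>R d)) has_real_derivative d \<bullet> g) (at t)"
proof -
  have "((\<lambda>t. f (x + t *\<^sub>R d)) has_derivative (\<lambda>s. (s *\<^sub>R d) \<bullet> g)) (at t)"
    by (rule has_derivative_compose[where f = "\<lambda>t. x + t *\<^sub>R d" and g = f, unfolded o_def])
      (use assms in \<open>auto intro!: derivative_eq_intros simp: gderiv_def\<close>)
  then show ?thesis
    by (simp add: has_field_derivative_def mult.commute mult_commute_abs)
qed

text \<open>The descent lemma: along the segment from \<open>x\<close> to \<open>y\<close> the
  difference of both sides has nonpositive derivative, by Cauchy-Schwarz and the Lipschitz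
  bound.\<close>

lemma smooth_fun_upper:
  assumes "smooth_fun L f"
  shows "f y \<le> f x + (y - x) \<bullet> grad f x + L / 2 * (norm (y - x))\<^sup>2"
proof -
  define d where "d = y - x"
  define p where "p t = f (x + t *\<^sub>R d) - t * (d \<bullet> grad f x) - L / 2 * t\<^sup>2 * (norm d)\<^sup>2" for t
  have der: "(p has_real_derivative d \<bullet> grad f (x + t *\<^sub>R d) - d \<bullet> grad f x - L * t * (norm d)\<^sup>2) (at t)" for t
    unfolding p_def
    by (auto intro!: derivative_eq_intros gderiv_line smooth_fun_gderiv[OF assms])
  have neg: "d \<bullet> grad f (x + t *\<^sub>R d) - d \<bullet> grad f x - L * t * (norm d)\<^sup>2 \<le> 0" if "0 \<le> t" for t
  proof -
    have "d \<bullet> (grad f (x + t *\<^sub>R d) - grad f x) \<le> norm d * norm (grad f (x + t *\<^sub>R d) - grad f x)"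
      by (rule norm_cauchy_schwarz)
    also have "\<dots> \<le> norm d * (L * norm (t *\<^sub>R d))"
      using smooth_fun_lipschitz[OF assms, of "x + t *\<^sub>R d" x] by (intro mult_left_mono) auto
    finally show ?thesis using that by (simp add: inner_diff_right power2_eq_square mult_ac)
  qed
  have "p 1 \<le> p 0"
    by (rule DERIV_nonpos_imp_nonincreasing[of 0 1]) (use der neg in force)+
  then show ?thesis by (simp add: p_def d_def)
qed

lemma convex_on_above_gderiv:
  assumes "convex_on UNIV f" "GDERIV f x :> g"
  shows "f y \<ge> f x + (y - x) \<bullet> g"
proof -
  define p where "p t = f (x + t *\<^sub>R (y - x))" for t :: real
  have "convex_on UNIV p"
  proof (rule convex_onI)
    fix t s u :: real assume t: "0 < t" "t < 1"
    have e: "x + ((1 - t) *\<^sub>R s + t *\<^sub>R u) *\<^sub>R (y - x)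
        = (1 - t) *\<^sub>R (x + s *\<^sub>R (y - x)) + t *\<^sub>R (x + u *\<^sub>R (y - x))"
      by (simp add: algebra_simps)
    show "p ((1 - t) *\<^sub>R s + t *\<^sub>R u) \<le> (1 - t) * p s + t * p u"
      unfolding p_def e using t by (intro convex_onD[OF assms(1)]) auto
  qed simp
  moreover have "(p has_real_derivative (y - x) \<bullet> g) (at 0)"
    unfolding p_def by (rule gderiv_line) (use assms(2) in simp)
  ultimately have "p 1 - p 0 \<ge> (y - x) \<bullet> g * (1 - 0)"
    by (intro convex_on_imp_above_tangent[where A = UNIV]) auto
  then show ?thesis by (simp add: p_def)
qed

lemma strongly_convex_above_gderiv:
  assumes "strongly_convex \<mu> f" "GDERIV f x :> g"
  shows "f y \<ge> f x + (y - x) \<bullet> g + \<mu> / 2 * (norm (y - x))\<^sup>2"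
proof -
  have "GDERIV (\<lambda>x. f x - \<mu> / 2 * (norm x)\<^sup>2) x :> g - \<mu> *\<^sub>R x"
    using assms(2) unfolding gderiv_def power2_norm_eq_inner
    by (auto intro!: derivative_eq_intros simp: algebra_simps inner_commute)
  from convex_on_above_gderiv[OF assms(1)[unfolded strongly_convex_def] this, of y]
  show ?thesis
    by (simp add: power2_norm_eq_inner algebra_simps inner_commute)
qed

text \<open>Meant for \<open>Psi\<close>, whose gradient is at first only a candidate: the tangent
  inequalities at \<open>x\<close> and at \<open>y\<close> squeeze the remainder between zero and a
  multiple of the squared distance.\<close>

lemma tangent_lipschitz_imp_gderiv:
  assumes tangent: "\<And>x y. F y \<ge> F x + (y - x) \<bullet> g x"
    and lip: "\<And>x y. norm (g x - g y) \<le> L * norm (x - y)"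
  shows "GDERIV F x :> g x"
proof -
  have bnd: "\<bar>F y - F x - (y - x) \<bullet> g x\<bar> \<le> \<bar>L\<bar> * norm (y - x) * norm (y - x)" for y
  proof -
    have "F y - F x - (y - x) \<bullet> g x \<le> (y - x) \<bullet> (g y - g x)"
      using tangent[where x = y and y = x] by (simp add: inner_diff)
    also have "\<dots> \<le> norm (y - x) * norm (g y - g x)" by (rule norm_cauchy_schwarz)
    also have "\<dots> \<le> norm (y - x) * (\<bar>L\<bar> * norm (y - x))"
      using order_trans[OF lip[of y x] mult_right_mono[OF abs_ge_self norm_ge_zero]]
      by (intro mult_left_mono) auto
    finally show ?thesis using tangent[of x y] by (simp add: mult_ac)
  qed
  show ?thesis unfolding gderiv_def has_derivative_at2
  proof (intro conjI bounded_linear_inner_left)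
    have "((\<lambda>y. \<bar>L\<bar> * norm (y - x)) \<longlongrightarrow> \<bar>L\<bar> * norm (x - x)) (at x)"
      by (intro tendsto_intros)
    then have lim: "((\<lambda>y. \<bar>L\<bar> * norm (y - x)) \<longlongrightarrow> 0) (at x)" by simp
    show "((\<lambda>y. (1 / norm (y - x)) *\<^sub>R (F y - (F x + (y - x) \<bullet> g x))) \<longlongrightarrow> 0) (at x)"
    proof (rule Lim_null_comparison[OF _ lim], rule always_eventually, rule allI)
      fix y
      show "norm ((1 / norm (y - x)) *\<^sub>R (F y - (F x + (y - x) \<bullet> g x))) \<le> \<bar>L\<bar> * norm (y - x)"
        using bnd[of y] by (cases "y = x") (auto simp: pos_divide_le_eq diff_diff_eq)
    qed
  qed
qed

lemma smooth_convex_cocoercive: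
  assumes sm: "smooth_fun L f" and L: "0 < L"
    and tangent: "\<And>x y. f y \<ge> f x + (y - x) \<bullet> grad f x"
  shows "f y \<ge> f x + (y - x) \<bullet> grad f x + (norm (grad f y - grad f x))\<^sup>2 / (2 * L)"
proof -
  define d where "d = grad f y - grad f x"
  \<comment> \<open>A gradient step from \<open>y\<close> for \<open>f\<close> minus its tangent at
    \<open>x\<close>. The descent lemma at \<open>y\<close> bounds \<open>f z\<close> from above,
    the tangent at \<open>x\<close> bounds it from below.\<close>
  define z where "z = y - (1 / L) *\<^sub>R d"
  have "f z \<le> f y + (z - y) \<bullet> grad f y + L / 2 * (norm (z - y))\<^sup>2"
    by (rule smooth_fun_upper[OF sm])
  moreover have "f z \<ge> f x + (z - x) \<bullet> grad f x" by (rule tangent)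
  moreover have "(z - y) \<bullet> grad f y = - (d \<bullet> grad f y) / L" by (simp add: z_def)
  moreover have "(norm (z - y))\<^sup>2 = (d \<bullet> d) / L\<^sup>2"
    using L by (simp add: z_def power2_norm_eq_inner power_divide power_mult_distrib)
  moreover have "(z - x) \<bullet> grad f x = (y - x) \<bullet> grad f x - (d \<bullet> grad f x) / L"
    by (simp add: z_def algebra_simps)
  ultimately have "f y \<ge> f x + (y - x) \<bullet> grad f x + (d \<bullet> grad f y) / L - (d \<bullet> grad f x) / L
      - L / 2 * ((d \<bullet> d) / L\<^sup>2)"
    by simp
  moreover have "(d \<bullet> grad f y) / L - (d \<bullet> grad f x) / L = (d \<bullet> d) / L"
    by (simp add: d_def inner_diff_right diff_divide_distrib)
  moreover have "L / 2 * ((d \<bullet> d) / L\<^sup>2) = (d \<bullet> d) / (2 * L)"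
    using L by (simp add: field_simps power2_eq_square)
  ultimately show ?thesis
    unfolding d_def[symmetric] power2_norm_eq_inner by (simp add: field_simps)
qed


section \<open>Accelerated gradient descent\<close>

lemma strongly_convex_minimizer:
  fixes F :: "'a::euclidean_space \<Rightarrow> real"
  assumes \<mu>: "0 < \<mu>" and sm: "smooth_fun L F"
    and tangent: "\<And>x y. F y \<ge> F x + (y - x) \<bullet> grad F x + \<mu> / 2 * (norm (y - x))\<^sup>2"
  obtains x where "grad F x = 0" "\<And>y. F x \<le> F y"
proof -
  \<comment> \<open>Beyond this radius the quadratic term of the tangent inequality at
    \<open>0\<close> outweighs the linear one, so a minimiser over the ball is a global one.\<close>
  define r where "r = 2 / \<mu> * norm (grad F 0)"
  have r: "0 \<le> r" using \<mu> by (simp add: r_def)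
  have "continuous_on UNIV F"
    using smooth_fun_gderiv[OF sm] unfolding gderiv_def
    by (metis has_derivative_continuous continuous_at_imp_continuous_on)
  then have "continuous_on (cball 0 r) F" by (rule continuous_on_subset) simp
  moreover have "cball (0 :: 'a) r \<noteq> {}" using r by simp
  ultimately obtain x where "\<forall>y\<in>cball 0 r. F x \<le> F y"
    using continuous_attains_inf[OF compact_cball] by metis
  then have x: "F x \<le> F y" if "norm y \<le> r" for y using that by simp
  have min: "F x \<le> F y" for y
  proof (cases "norm y \<le> r")
    case False
    then have "2 * norm (grad F 0) \<le> \<mu> * norm y" using \<mu> by (simp add: r_def field_simps)
    then have "norm (grad F 0) * norm y \<le> \<mu> / 2 * (norm y)\<^sup>2"
      using mult_right_mono[of "2 * norm (grad F 0)" "\<mu> * norm y" "norm y"]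
      by (simp add: power2_eq_square)
    moreover have "- (norm (grad F 0) * norm y) \<le> y \<bullet> grad F 0"
      using Cauchy_Schwarz_ineq2[of y "grad F 0"] by (simp add: mult.commute)
    ultimately have "F 0 \<le> F y" using tangent[where x = 0 and y = y] by simp
    then show ?thesis using x[of 0] r by simp
  qed (rule x)
  have "(\<lambda>h. h \<bullet> grad F x) = (\<lambda>h. 0)"
    by (rule differential_zero_maxmin[where f = F and x = x and S = UNIV])
      (use smooth_fun_gderiv[OF sm] min in \<open>auto simp: gderiv_def\<close>)
  then have "grad F x \<bullet> grad F x = 0" by metis
  then show ?thesis using that min by simp
qed

text \<open>Strong convexity enters as a tangent inequality, the form in which it is obtained for
  \<open>Psi\<close>.\<close>

locale agd =
  fixes F :: "'a::euclidean_space \<Rightarrow> real" and L \<mu> :: real and y0 :: 'a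
  assumes smooth: "smooth_fun L F"
    and mu_pos: "0 < \<mu>"
    and tangent: "F y \<ge> F x + (y - x) \<bullet> grad F x + \<mu> / 2 * (norm (y - x))\<^sup>2"
begin

lemma tangent0: "F y \<ge> F x + (y - x) \<bullet> grad F x"
proof -
  have "0 \<le> \<mu> / 2 * (norm (y - x))\<^sup>2" using mu_pos by simp
  then show ?thesis using tangent[of x y] by linarith
qed

lemma mu_le_L: "\<mu> \<le> L"
proof -
  obtain u :: 'a where u: "norm u = 1" by (rule vector_choose_size[of 1]) auto
  have "F u + (0 - u) \<bullet> grad F u + \<mu> / 2 \<le> F 0" "F 0 + u \<bullet> grad F 0 + \<mu> / 2 \<le> F u"
    using tangent[where x = u and y = 0] tangent[where x = 0 and y = u] u by auto
  then have "\<mu> \<le> u \<bullet> (grad F u - grad F 0)" by (simp add: inner_diff_right)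
  also have "\<dots> \<le> norm u * norm (grad F u - grad F 0)" by (rule norm_cauchy_schwarz)
  also have "\<dots> \<le> L" using smooth_fun_lipschitz[OF smooth, of u 0] u by simp
  finally show ?thesis .
qed

lemma L_pos: "0 < L" using mu_le_L mu_pos by simp

definition a :: real where "a = sqrt (\<mu> / L)"

lemma a: "0 < a" "a \<le> 1" "a\<^sup>2 = \<mu> / L"
  using mu_pos L_pos mu_le_L by (auto simp: a_def)

lemma a_eq: "a = 1 / sqrt (L / \<mu>)"
  by (simp add: a_def real_sqrt_divide)

abbreviation y :: "nat \<Rightarrow> 'a" where "y k \<equiv> agd_iter F L \<mu> y0 k"

text \<open>The auxiliary sequence of the estimate-sequence argument, in terms of the last two iterates.\<close>

definition v :: "nat \<Rightarrow> 'a" where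
  "v k = (let (p, p') = agd_pair F L \<mu> y0 k in p' + (1 / a) *\<^sub>R (p - p'))"

lemma momentum: "(sqrt (L / \<mu>) - 1) / (sqrt (L / \<mu>) + 1) = (1 - a) / (1 + a)"
  using mu_pos L_pos by (simp add: a_eq field_simps add_nonneg_eq_0_iff)

text \<open>The momentum step as an estimate sequence: \<open>z\<close> is the average of
  \<open>y k\<close> and \<open>v k\<close> with weights proportional to \<open>1\<close> and
  \<open>a\<close>, and \<open>v\<close> moves towards \<open>z\<close> and then along the negative
  gradient.\<close>

lemma agd_step:
  obtains z where "y k = z - a *\<^sub>R (v k - z)"
    "y (Suc k) = z - (1 / L) *\<^sub>R grad F z"
    "v (Suc k) = z + (1 - a) *\<^sub>R (v k - z) - (a / \<mu>) *\<^sub>R grad F z"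
proof -
  obtain p p' where pp: "agd_pair F L \<mu> y0 k = (p, p')" by fastforce
  define z where "z = p + ((1 - a) / (1 + a)) *\<^sub>R (p - p')"
  have suc: "agd_pair F L \<mu> y0 (Suc k) = (z - (1 / L) *\<^sub>R grad F z, p)"
    using pp momentum by (simp add: z_def Let_def)
  have v: "v k = p' + (1 / a) *\<^sub>R (p - p')" by (simp add: v_def pp)
  have "(1 + a) *\<^sub>R z = (1 + a) *\<^sub>R p + (1 - a) *\<^sub>R (p - p')"
    using a by (simp add: z_def scaleR_add_right)
  also have "\<dots> = p + a *\<^sub>R v k" using a by (simp add: v algebra_simps)
  finally have zv: "p = z - a *\<^sub>R (v k - z)" by (simp add: algebra_simps)
  have "a * (1 / L) = a / L" "1 / (a * L) = a / \<mu>"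
    using a mu_pos L_pos by (auto simp: field_simps power2_eq_square)
  then have "v (Suc k) = p + (1 / a) *\<^sub>R (z - p) - (a / \<mu>) *\<^sub>R grad F z"
    by (simp add: v_def suc algebra_simps del: agd_pair.simps)
  also have "(1 / a) *\<^sub>R (z - p) = v k - z" using a by (simp add: zv)
  finally have "v (Suc k) = z + (1 - a) *\<^sub>R (v k - z) - (a / \<mu>) *\<^sub>R grad F z"
    using zv by (simp add: algebra_simps)
  moreover have "y k = p" "y (Suc k) = z - (1 / L) *\<^sub>R grad F z"
    using pp suc by (simp_all add: agd_iter_def del: agd_pair.simps)
  ultimately show ?thesis using that zv by metis
qed

text \<open>Sum of the descent at \<open>z\<close>, \<open>a\<close> times the tangent inequality
  from \<open>z\<close> to \<open>xs\<close>, \<open>1 - a\<close> times the one from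
  \<open>z\<close> to \<open>y k\<close>, and the expanded square of \<open>v (Suc k) - xs\<close>.
  All inner products with \<open>g\<close> cancel, the term \<open>g \<bullet> g\<close> because
  \<open>a\<^sup>2 = \<mu> / L\<close>.\<close>

lemma lyapunov_step:
  "F (y (Suc k)) - F xs + \<mu> / 2 * (norm (v (Suc k) - xs))\<^sup>2
    \<le> (1 - a) * (F (y k) - F xs + \<mu> / 2 * (norm (v k - xs))\<^sup>2)"
proof -
  obtain z where z: "y k = z - a *\<^sub>R (v k - z)"
    "y (Suc k) = z - (1 / L) *\<^sub>R grad F z"
    "v (Suc k) = z + (1 - a) *\<^sub>R (v k - z) - (a / \<mu>) *\<^sub>R grad F z"
    by (rule agd_step)
  define g u e where "g = grad F z" and "u = v k - z" and "e = z - xs"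
  have 1: "F (y (Suc k)) \<le> F z - (g \<bullet> g) / (2 * L)"
  proof -
    have "F (y (Suc k)) \<le> F z + (y (Suc k) - z) \<bullet> g + L / 2 * (norm (y (Suc k) - z))\<^sup>2"
      unfolding g_def by (rule smooth_fun_upper[OF smooth])
    also have "\<dots> = F z - (g \<bullet> g) / (2 * L)"
    proof -
      have "(norm (y (Suc k) - z))\<^sup>2 = (g \<bullet> g) / L\<^sup>2"
        using L_pos by (simp add: z(2) g_def[symmetric] power2_norm_eq_inner power_divide power_mult_distrib)
      moreover have "(y (Suc k) - z) \<bullet> g = - (g \<bullet> g) / L" by (simp add: z(2) g_def[symmetric])
      ultimately show ?thesis using L_pos by (simp add: field_simps power2_eq_square)
    qed
    finally show ?thesis .
  qed
  have "F xs \<ge> F z + (xs - z) \<bullet> g + \<mu> / 2 * (norm (xs - z))\<^sup>2"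
    unfolding g_def by (rule tangent)
  then have 2: "a * (F z - F xs) \<le> a * (e \<bullet> g - \<mu> / 2 * (e \<bullet> e))"
    using a(1) by (intro mult_left_mono) (auto simp: e_def power2_norm_eq_inner algebra_simps inner_commute)
  have "0 \<le> \<mu> / 2 * (norm (y k - z))\<^sup>2" using mu_pos by simp
  then have "F (y k) \<ge> F z + (y k - z) \<bullet> g"
    using tangent[where x = z and y = "y k"] unfolding g_def by linarith
  then have 3: "(1 - a) * (F z - F xs) \<le> (1 - a) * (F (y k) - F xs + a * (u \<bullet> g))"
    using a(2) by (intro mult_left_mono) (auto simp: z(1) u_def)
  have 4: "\<mu> / 2 * (norm (v (Suc k) - xs))\<^sup>2
      = \<mu> / 2 * (norm (e + (1 - a) *\<^sub>R u))\<^sup>2 - a * (e \<bullet> g) - a * (1 - a) * (u \<bullet> g) + (g \<bullet> g) / (2 * L)"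
  proof -
    have "v (Suc k) - xs = (e + (1 - a) *\<^sub>R u) - (a / \<mu>) *\<^sub>R g"
      by (simp add: z(3) e_def u_def g_def)
    then have "(norm (v (Suc k) - xs))\<^sup>2 = (norm (e + (1 - a) *\<^sub>R u))\<^sup>2
        - 2 * (a / \<mu>) * ((e + (1 - a) *\<^sub>R u) \<bullet> g) + (a / \<mu>)\<^sup>2 * (g \<bullet> g)"
      unfolding power2_norm_eq_inner
      by (simp only: power2_eq_square[of "a / \<mu>"]) (simp add: inner_diff inner_commute algebra_simps add_divide_distrib)
    also have "(a / \<mu>)\<^sup>2 = 1 / (L * \<mu>)"
      using mu_pos by (simp add: power_divide a(3)) (simp add: power2_eq_square)
    finally have eq: "(norm (v (Suc k) - xs))\<^sup>2 = (norm (e + (1 - a) *\<^sub>R u))\<^sup>2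
        - 2 * (a / \<mu>) * ((e + (1 - a) *\<^sub>R u) \<bullet> g) + 1 / (L * \<mu>) * (g \<bullet> g)" .
    have "\<mu> / 2 * (n - 2 * (a / \<mu>) * p + 1 / (L * \<mu>) * q) = \<mu> / 2 * n - a * p + q / (2 * L)"
      for n p q using mu_pos L_pos by (simp add: field_simps)
    moreover have "a * ((e + (1 - a) *\<^sub>R u) \<bullet> g) = a * (e \<bullet> g) + a * (1 - a) * (u \<bullet> g)"
      by (simp add: inner_add_left algebra_simps)
    ultimately show ?thesis unfolding eq by simp
  qed
  have 5: "(norm (e + (1 - a) *\<^sub>R u))\<^sup>2 \<le> (1 - a) * (norm (e + u))\<^sup>2 + a * (e \<bullet> e)"
  proof -
    have "(1 - a) * (norm (e + u))\<^sup>2 + a * (e \<bullet> e) - (norm (e + (1 - a) *\<^sub>R u))\<^sup>2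
        = a * (1 - a) * (u \<bullet> u)"
      unfolding power2_norm_eq_inner by (simp add: inner_add inner_diff inner_commute algebra_simps)
    moreover have "0 \<le> a * (1 - a) * (u \<bullet> u)" using a by simp
    ultimately show ?thesis by linarith
  qed
  have 6: "e + u = v k - xs" by (simp add: e_def u_def)
  have "\<mu> / 2 * (norm (e + (1 - a) *\<^sub>R u))\<^sup>2
      \<le> \<mu> / 2 * ((1 - a) * (norm (v k - xs))\<^sup>2 + a * (e \<bullet> e))"
    using 5 mu_pos unfolding 6 by (intro mult_left_mono) auto
  with 1 2 3 4 show ?thesis by (simp add: algebra_simps diff_divide_distrib)
qed

lemma lyapunov:
  "F (y k) - F xs + \<mu> / 2 * (norm (v k - xs))\<^sup>2
    \<le> (1 - a) ^ k * (F y0 - F xs + \<mu> / 2 * (norm (y0 - xs))\<^sup>2)"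
proof (induction k)
  case 0
  show ?case by (simp add: agd_iter_def v_def)
next
  case (Suc k)
  have "(1 - a) * (F (y k) - F xs + \<mu> / 2 * (norm (v k - xs))\<^sup>2)
    \<le> (1 - a) * ((1 - a) ^ k * (F y0 - F xs + \<mu> / 2 * (norm (y0 - xs))\<^sup>2))"
    using Suc a by (intro mult_left_mono) auto
  then show ?case using lyapunov_step[of k xs] by simp
qed

text \<open>Cocoercivity bounds the squared gradient by \<open>2 * L\<close> times the gap in
  \<open>F\<close>, and the Lyapunov function starts at no more than \<open>L\<close> times the
  squared initial distance.\<close>

lemma grad_bound:
  assumes xs: "grad F xs = 0"
  shows "(norm (grad F (y k)))\<^sup>2 \<le> 2 * L\<^sup>2 * (norm (y0 - xs))\<^sup>2 * exp (- a * k)"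
proof -
  have "(norm (grad F (y k)))\<^sup>2 / (2 * L) \<le> F (y k) - F xs"
    using smooth_convex_cocoercive[OF smooth L_pos tangent0, of xs "y k"] xs by simp
  also have "\<dots> \<le> F (y k) - F xs + \<mu> / 2 * (norm (v k - xs))\<^sup>2" using mu_pos by simp
  also have "\<dots> \<le> (1 - a) ^ k * (F y0 - F xs + \<mu> / 2 * (norm (y0 - xs))\<^sup>2)"
    by (rule lyapunov)
  also have "\<dots> \<le> exp (- a * k) * (L * (norm (y0 - xs))\<^sup>2)"
  proof (rule mult_mono)
    have "(1 - a) ^ k \<le> exp (- a) ^ k"
      using a(2) exp_ge_add_one_self[of "- a"] by (intro power_mono) auto
    then show "(1 - a) ^ k \<le> exp (- a * k)" using exp_of_nat2_mult[of "- a" k] by simp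
    have "F y0 - F xs \<le> L / 2 * (norm (y0 - xs))\<^sup>2"
      using smooth_fun_upper[OF smooth, of y0 xs] xs by simp
    moreover have "\<mu> / 2 * (norm (y0 - xs))\<^sup>2 \<le> L / 2 * (norm (y0 - xs))\<^sup>2"
      using mu_le_L by (intro mult_right_mono) auto
    ultimately show "F y0 - F xs + \<mu> / 2 * (norm (y0 - xs))\<^sup>2 \<le> L * (norm (y0 - xs))\<^sup>2"
      by simp
    show "0 \<le> F y0 - F xs + \<mu> / 2 * (norm (y0 - xs))\<^sup>2"
      using tangent0[of xs y0] xs mu_pos by simp
  qed simp
  finally show ?thesis
    using L_pos by (simp add: field_simps power2_eq_square)
qed

text \<open>\<open>R\<close> is the ratio of the initial distance to the target accuracy; the step
  count depends on it and on the condition number alone, so a good warm start keeps it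
  bounded.\<close>

lemma agd_stop:
  assumes xs: "grad F xs = 0" and \<delta>: "0 < \<delta>" and R: "norm (y0 - xs) \<le> R * \<delta>" "0 < R"
    and t: "sqrt (L / \<mu>) * ln (2 * (L / \<mu>)\<^sup>2 * R\<^sup>2) \<le> real t"
  shows "agd_stop F L \<mu> y0 \<delta> t"
proof -
  have "ln (2 * (L / \<mu>)\<^sup>2 * R\<^sup>2) \<le> a * t"
    using t mu_pos L_pos by (simp add: a_eq field_simps)
  then have "exp (- a * t) \<le> exp (- ln (2 * (L / \<mu>)\<^sup>2 * R\<^sup>2))" by simp
  also have "\<dots> = 1 / (2 * (L / \<mu>)\<^sup>2 * R\<^sup>2)"
    using mu_pos L_pos R by (subst exp_minus, subst exp_ln) (auto simp: inverse_eq_divide)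
  finally have e: "exp (- a * t) \<le> 1 / (2 * (L / \<mu>)\<^sup>2 * R\<^sup>2)" .
  have "(norm (grad F (y t)))\<^sup>2 \<le> 2 * L\<^sup>2 * (norm (y0 - xs))\<^sup>2 * exp (- a * t)"
    by (rule grad_bound[OF xs])
  also have "\<dots> \<le> 2 * L\<^sup>2 * (R * \<delta>)\<^sup>2 * (1 / (2 * (L / \<mu>)\<^sup>2 * R\<^sup>2))"
    using R e L_pos by (intro mult_mono power_mono) auto
  also have "\<dots> = (\<mu> * \<delta>)\<^sup>2"
    using mu_pos L_pos R by (simp add: field_simps)
  finally show ?thesis
    unfolding agd_stop_def using mu_pos \<delta> by (rule_tac power2_le_imp_le) auto
qed

text \<open>Strong convexity turns the gradient test with threshold \<open>\<mu> * \<delta>\<close>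
  into a distance of at most \<open>\<delta>\<close>.\<close>

lemma agd_out_dist:
  assumes xs: "grad F xs = 0" and "agd_halts F L \<mu> y0 \<delta>"
  shows "norm (agd_out F L \<mu> y0 \<delta> - xs) \<le> \<delta>"
proof -
  define x where "x = agd_out F L \<mu> y0 \<delta>"
  have stop: "norm (grad F x) \<le> \<mu> * \<delta>"
    using assms(2) LeastI_ex[of "agd_stop F L \<mu> y0 \<delta>"]
    unfolding agd_halts_def x_def agd_out_def agd_steps_def agd_stop_def by blast
  have "F x \<ge> F xs + \<mu> / 2 * (norm (x - xs))\<^sup>2"
    using tangent[where x = xs and y = x] xs by simp
  moreover have "F xs \<ge> F x + (xs - x) \<bullet> grad F x + \<mu> / 2 * (norm (x - xs))\<^sup>2"
    using tangent[where x = x and y = xs] by (simp add: norm_minus_commute)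
  ultimately have "\<mu> * (norm (x - xs))\<^sup>2 \<le> (x - xs) \<bullet> grad F x" by (simp add: inner_diff_left)
  also have "\<dots> \<le> norm (x - xs) * norm (grad F x)" by (rule norm_cauchy_schwarz)
  also have "\<dots> \<le> norm (x - xs) * (\<mu> * \<delta>)" using stop by (intro mult_left_mono) auto
  finally have "norm (x - xs) * norm (x - xs) \<le> norm (x - xs) * \<delta>"
    using mu_pos by (simp add: power2_eq_square)
  moreover have "0 \<le> \<delta>" using order_trans[OF norm_ge_zero stop] mu_pos by (simp add: zero_le_mult_iff)
  ultimately show ?thesis unfolding x_def[symmetric]
    by (cases "x = xs") auto
qed

end


section \<open>Subgradients, conjugates and proximal points\<close>

text \<open>The real witness \<open>t\<close> makes finiteness at \<open>x\<close> part of the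
  notion and keeps later arithmetic within the reals.\<close>

definition subgradient :: "('a::real_inner \<Rightarrow> ereal) \<Rightarrow> 'a \<Rightarrow> 'a \<Rightarrow> bool" where
  "subgradient g v x \<longleftrightarrow> (\<exists>t. g x = ereal t \<and> (\<forall>y. ereal (t + (y - x) \<bullet> v) \<le> g y))"

lemma subgradient_monotone:
  assumes "subgradient g v x" "subgradient g w y"
  shows "(v - w) \<bullet> (x - y) \<ge> 0"
proof -
  obtain t s where "g x = ereal t" "g y = ereal s"
    "ereal (t + (y - x) \<bullet> v) \<le> g y" "ereal (s + (x - y) \<bullet> w) \<le> g x"
    using assms unfolding subgradient_def by blast
  then show ?thesis by (simp add: inner_diff inner_commute)
qed

text \<open>The subgradient inequality says that \<open>z\<close> attains the supremum that defines
  \<open>conjugate h v\<close> (equality in Fenchel-Young). The same \<open>z\<close> remains a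
  candidate at every other point, which is the inequality for the conjugate.\<close>

lemma subgradient_conjugate:
  assumes "subgradient h v z"
  shows "subgradient (conjugate h) z v" "conjugate h v = ereal (z \<bullet> v) - h z"
proof -
  obtain t where t: "h z = ereal t" "\<And>y. ereal (t + (y - z) \<bullet> v) \<le> h y"
    using assms unfolding subgradient_def by blast
  show eq: "conjugate h v = ereal (z \<bullet> v) - h z"
    unfolding conjugate_def
  proof (rule antisym[OF SUP_least])
    fix y
    show "ereal (y \<bullet> v) - h y \<le> ereal (z \<bullet> v) - h z"
      using t(2)[of y] unfolding t(1) by (cases "h y") (auto simp: inner_diff_left)
  qed (rule SUP_upper, simp)
  have "ereal (z \<bullet> v - t + (y - v) \<bullet> z) \<le> conjugate h y" for y
  proof -
    have "ereal (z \<bullet> y) - h z \<le> conjugate h y" unfolding conjugate_def by (rule SUP_upper) simp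
    then show ?thesis unfolding t(1) by (simp add: inner_diff_left inner_commute algebra_simps)
  qed
  then show "subgradient (conjugate h) z v"
    unfolding subgradient_def by (intro exI[of _ "z \<bullet> v - t"]) (simp add: eq t(1))
qed

lemma mem_epigraph_conjugate:
  assumes "\<forall>z. h z \<noteq> - \<infinity>"
  shows "(v, t) \<in> epigraph (conjugate h) \<longleftrightarrow> (\<forall>z. h z \<noteq> \<infinity> \<longrightarrow> z \<bullet> v - real_of_ereal (h z) \<le> t)"
proof -
  have "ereal (z \<bullet> v) - h z \<le> ereal t \<longleftrightarrow> (h z \<noteq> \<infinity> \<longrightarrow> z \<bullet> v - real_of_ereal (h z) \<le> t)" for z
    using assms by (cases "h z") auto
  then show ?thesis by (simp add: epigraph_def conjugate_def SUP_le_iff)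
qed

text \<open>The epigraph of a conjugate is an intersection of closed half-spaces, one for each point
  of the domain of \<open>h\<close>.\<close>

lemma proper_closed_convex_conjugate:
  assumes h: "\<forall>z. h z \<noteq> - \<infinity>" "h z0 \<noteq> \<infinity>" and fin: "conjugate h v0 \<noteq> \<infinity>"
  shows "proper_closed_convex (conjugate h)"
proof -
  let ?H = "\<lambda>z. {p. z \<bullet> fst p - real_of_ereal (h z) \<le> snd p}"
  have eq: "epigraph (conjugate h) = (\<Inter>z\<in>{z. h z \<noteq> \<infinity>}. ?H z)"
    by (auto simp: mem_epigraph_conjugate[OF h(1)])
  have "conjugate h v \<noteq> - \<infinity>" for v
  proof -
    have "ereal (z0 \<bullet> v) - h z0 \<le> conjugate h v" unfolding conjugate_def by (rule SUP_upper) simp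
    then show ?thesis using h by (cases "h z0") auto
  qed
  moreover have "closed (?H z)" for z
    by (intro closed_Collect_le continuous_intros)
  moreover have "convex (?H z)" for z
  proof -
    have "?H z = {p. (z, -1) \<bullet> p \<le> real_of_ereal (h z)}" by (auto simp: inner_prod_def)
    then show ?thesis by (simp add: convex_halfspace_le)
  qed
  ultimately show ?thesis
    unfolding proper_closed_convex_def eq using fin by (intro conjI closed_INT convex_INT) auto
qed

text \<open>Division by \<open>r\<close> and \<open>r\<close> tending to zero: the first-order
  optimality argument, in a form that suits comparisons of an optimal point with nearby
  points.\<close>

lemma linear_le_quadratic_imp_nonpos:
  fixes \<gamma> N :: real
  assumes "\<And>r. 0 < r \<Longrightarrow> r \<le> 1 \<Longrightarrow> r * \<gamma> \<le> r\<^sup>2 * N"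
  shows "\<gamma> \<le> 0"
proof (rule ccontr)
  assume "\<not> ?thesis"
  then have \<gamma>: "0 < \<gamma>" by simp
  define r where "r = \<gamma> / (\<gamma> + \<bar>N\<bar> + 1)"
  have r: "0 < r" "r \<le> 1" using \<gamma> by (auto simp: r_def)
  have "r * \<gamma> \<le> r * (r * N)" using assms[OF r] by (simp add: power2_eq_square mult.assoc)
  then have "\<gamma> \<le> r * N" using r by simp
  also have "\<dots> \<le> r * \<bar>N\<bar>" using r by (intro mult_left_mono) auto
  finally have "\<gamma> * (\<gamma> + 1) \<le> 0" using \<gamma> by (simp add: r_def field_simps)
  then show False using \<gamma> by (simp add: mult_le_0_iff)
qed

text \<open>The minimum is taken over the epigraph, so that only a continuous function has to be minimised
  on a compact set.\<close>

lemma proximal_point_exists: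
  fixes g :: "'a::euclidean_space \<Rightarrow> ereal"
  assumes pcc: "proper_closed_convex g" and minorant: "\<And>u. ereal (u \<bullet> z0 - c0) \<le> g u"
    and ell: "0 < ell"
  obtains l where "subgradient g (w - ell *\<^sub>R (l - l')) l"
proof -
  \<comment> \<open>The second coordinate stands in for the value of \<open>g\<close>, which need
    not be continuous.\<close>
  define q where "q p = snd p + ell / 2 * (norm (fst p - l'))\<^sup>2 - fst p \<bullet> w" for p :: "'a \<times> real"
  have cl: "closed (epigraph g)" and cv: "convex (epigraph g)"
    using pcc by (auto simp: proper_closed_convex_def)
  obtain u1 t1 where "g u1 = ereal t1"
    using pcc unfolding proper_closed_convex_def by (metis ereal_cases)
  then have p1: "(u1, t1) \<in> epigraph g" by (simp add: epigraph_def)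
  have low: "u \<bullet> z0 - c0 \<le> t" if "(u, t) \<in> epigraph g" for u t
  proof -
    have "ereal (u \<bullet> z0 - c0) \<le> ereal t"
      using minorant[of u] that order_trans by (fastforce simp: epigraph_def)
    then show ?thesis by simp
  qed
  define S where "S = {p \<in> epigraph g. q p \<le> q (u1, t1)}"
  have qcont: "continuous_on A q" for A
    unfolding q_def by (intro continuous_intros)
  have "closed S"
    unfolding S_def
  proof -
    have "closed (epigraph g \<inter> {p. q p \<le> q (u1, t1)})"
      using cl qcont by (intro closed_Int closed_Collect_le continuous_on_const) auto
    then show "closed {p \<in> epigraph g. q p \<le> q (u1, t1)}" by (simp add: Collect_conj_eq)
  qed
  moreover have "bounded S"
  proof -
    define K where "K = q (u1, t1) + c0 - l' \<bullet> z0 + l' \<bullet> w"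
    \<comment> \<open>Outside this radius the quadratic term beats both the constant
      \<open>K\<close> and the linear term left by the affine minorant; the summand \<open>1\<close>
      allows \<open>\<bar>K\<bar>\<close> to be replaced by
      \<open>n * \<bar>K\<bar>\<close>.\<close>
    define B where "B = 1 + 2 / ell * (\<bar>K\<bar> + norm (z0 - w))"
    have B: "norm (u - l') \<le> B" if "(u, t) \<in> S" for u t
    proof (rule ccontr)
      define n where "n = norm (u - l')"
      assume "\<not> norm (u - l') \<le> B"
      then have n: "B < n" by (simp add: n_def)
      have "0 \<le> 2 / ell * (\<bar>K\<bar> + norm (z0 - w))" using ell by simp
      then have "1 < n" using n by (simp add: B_def)
      have "2 / ell * (\<bar>K\<bar> + norm (z0 - w)) < n" using n by (simp add: B_def)
      then have "\<bar>K\<bar> + norm (z0 - w) < ell / 2 * n" using ell by (simp add: field_simps)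
      then have "n * (\<bar>K\<bar> + norm (z0 - w)) < n * (ell / 2 * n)" using \<open>1 < n\<close> by simp
      moreover have "\<bar>K\<bar> \<le> n * \<bar>K\<bar>" using \<open>1 < n\<close> by (simp add: mult_le_cancel_right1)
      moreover have "- (n * norm (z0 - w)) \<le> (u - l') \<bullet> (z0 - w)"
        using Cauchy_Schwarz_ineq2[of "u - l'" "z0 - w"] by (simp add: n_def abs_le_iff)
      moreover have "ell / 2 * n\<^sup>2 + (u - l') \<bullet> (z0 - w) \<le> K"
        using that low[of u t] by (simp add: S_def q_def K_def n_def inner_diff)
      ultimately show False by (simp add: power2_eq_square algebra_simps)
    qed
    have sub: "S \<subseteq> cball l' B \<times> {- ((B + norm l') * norm z0 + \<bar>c0\<bar>) .. q (u1, t1) + (B + norm l') * norm w}"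
    proof (rule subrelI, rule SigmaI)
      fix u t assume ut: "(u, t) \<in> S"
      show "u \<in> cball l' B" using B[OF ut] by (simp add: dist_norm norm_minus_commute)
      have nu: "norm u \<le> B + norm l'" using B[OF ut] norm_triangle_sub[of u l'] by simp
      have "\<bar>u \<bullet> z\<bar> \<le> (B + norm l') * norm z" for z
        using Cauchy_Schwarz_ineq2[of u z] mult_right_mono[OF nu norm_ge_zero[of z]] by linarith
      from this[of z0] this[of w] have b: "- ((B + norm l') * norm z0) \<le> u \<bullet> z0" "u \<bullet> w \<le> (B + norm l') * norm w"
        by linarith+
      have "u \<bullet> z0 - c0 \<le> t" using ut low by (simp add: S_def)
      moreover have "t + ell / 2 * (norm (u - l'))\<^sup>2 - u \<bullet> w \<le> q (u1, t1)"
        using ut by (simp add: S_def q_def)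
      moreover have "0 \<le> ell / 2 * (norm (u - l'))\<^sup>2" using ell by simp
      ultimately have "- ((B + norm l') * norm z0 + \<bar>c0\<bar>) \<le> t" "t \<le> q (u1, t1) + (B + norm l') * norm w"
        using b by linarith+
      then show "t \<in> {- ((B + norm l') * norm z0 + \<bar>c0\<bar>) .. q (u1, t1) + (B + norm l') * norm w}"
        by simp
    qed
    show ?thesis
      by (rule bounded_subset[OF _ sub], rule bounded_Times) auto
  qed
  ultimately have "compact S" by (simp add: compact_eq_bounded_closed)
  moreover have "(u1, t1) \<in> S" using p1 by (simp add: S_def)
  ultimately obtain p where p: "p \<in> S" "\<And>p'. p' \<in> S \<Longrightarrow> q p \<le> q p'"
    using continuous_attains_inf[OF _ _ qcont, of S] by blast
  obtain l t where lt: "p = (l, t)" by fastforce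
  have pe: "(l, t) \<in> epigraph g" using p(1) by (simp add: S_def lt)
  have min: "q (l, t) \<le> q p'" if "p' \<in> epigraph g" for p'
  proof (cases "q p' \<le> q (u1, t1)")
    case True
    then show ?thesis using p(2)[of p'] that by (simp add: S_def lt)
  next
    case False
    then show ?thesis using p(1) by (simp add: S_def lt)
  qed
  \<comment> \<open>Comparison with points on the segment from the minimiser to
    \<open>(u, s)\<close>, which lies in the convex epigraph.\<close>
  have opt: "s \<ge> t + (u - l) \<bullet> (w - ell *\<^sub>R (l - l'))" if us: "(u, s) \<in> epigraph g" for u s
  proof -
    define \<gamma> where "\<gamma> = t + (u - l) \<bullet> (w - ell *\<^sub>R (l - l')) - s"
    define N where "N = ell / 2 * (norm (u - l))\<^sup>2"
    have "r * \<gamma> \<le> r\<^sup>2 * N" if r: "0 < r" "r \<le> 1" for r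
    proof -
      have "(1 - r) *\<^sub>R (l, t) + r *\<^sub>R (u, s) \<in> epigraph g"
        using r by (intro convexD[OF cv pe us]) auto
      then have "q (l, t) \<le> q ((1 - r) *\<^sub>R (l, t) + r *\<^sub>R (u, s))" by (rule min)
      also have "\<dots> = q (l, t) - r * \<gamma> + r\<^sup>2 * N"
      proof -
        have "(1 - r) *\<^sub>R l + r *\<^sub>R u - l' = (l - l') + r *\<^sub>R (u - l)" by (simp add: algebra_simps)
        then have "(norm ((1 - r) *\<^sub>R l + r *\<^sub>R u - l'))\<^sup>2
            = (norm (l - l'))\<^sup>2 + 2 * r * ((u - l) \<bullet> (l - l')) + r\<^sup>2 * (norm (u - l))\<^sup>2"
          by (simp only: power2_norm_eq_inner power2_eq_square[of r])
            (simp add: inner_add inner_commute algebra_simps)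
        then have "ell / 2 * (norm ((1 - r) *\<^sub>R l + r *\<^sub>R u - l'))\<^sup>2
            = ell / 2 * (norm (l - l'))\<^sup>2 + r * ((u - l) \<bullet> (ell *\<^sub>R (l - l'))) + r\<^sup>2 * N"
          by (simp only: distrib_left N_def inner_scaleR_right) simp
        then show ?thesis
          by (simp only: q_def \<gamma>_def fst_add snd_add fst_scaleR snd_scaleR fst_conv snd_conv
              real_scaleR_def inner_diff_right[of _ w]) (simp add: algebra_simps)
      qed
      finally show ?thesis by simp
    qed
    then have "\<gamma> \<le> 0" by (rule linear_le_quadratic_imp_nonpos)
    then show ?thesis by (simp add: \<gamma>_def)
  qed
  \<comment> \<open>The minimiser lies on the graph of \<open>g\<close>: \<open>opt\<close> applied
    to the graph point above \<open>l\<close> shows that \<open>t\<close> cannot exceed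
    \<open>g l\<close>.\<close>
  have gl: "g l = ereal t"
  proof -
    have "g l \<le> ereal t" using pe by (simp add: epigraph_def)
    then obtain t' where t': "g l = ereal t'"
      using pcc unfolding proper_closed_convex_def by (cases "g l") auto
    then have "t \<le> t'" using opt[of l t'] by (simp add: epigraph_def)
    then show ?thesis using \<open>g l \<le> ereal t\<close> t' by simp
  qed
  have "ereal (t + (u - l) \<bullet> (w - ell *\<^sub>R (l - l'))) \<le> g u" for u
  proof (cases "g u")
    case (real s)
    then show ?thesis using opt[of u s] by (simp add: epigraph_def)
  qed (use pcc in \<open>auto simp: proper_closed_convex_def\<close>)
  then show ?thesis using that gl unfolding subgradient_def by blast
qed

text \<open>Expanding the square around \<open>l\<close> turns the subgradient inequality into
  optimality of \<open>l\<close>.\<close>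

lemma proximal_value:
  assumes sub: "subgradient g (w - ell *\<^sub>R (l - l')) l" and ell: "0 \<le> ell"
  shows "(SUP u. ereal (u \<bullet> w) - g u - ereal (ell / 2 * (norm (u - l'))\<^sup>2))
    = ereal (l \<bullet> w - real_of_ereal (g l) - ell / 2 * (norm (l - l'))\<^sup>2)"
proof -
  obtain t where t: "g l = ereal t" "\<And>u. ereal (t + (u - l) \<bullet> (w - ell *\<^sub>R (l - l'))) \<le> g u"
    using sub unfolding subgradient_def by blast
  show ?thesis
  proof (rule antisym[OF SUP_least])
    fix u
    show "ereal (u \<bullet> w) - g u - ereal (ell / 2 * (norm (u - l'))\<^sup>2)
        \<le> ereal (l \<bullet> w - real_of_ereal (g l) - ell / 2 * (norm (l - l'))\<^sup>2)"
    proof (cases "g u")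
      case (real s)
      have "(norm (u - l'))\<^sup>2 = (norm (l - l'))\<^sup>2 + 2 * ((u - l) \<bullet> (l - l')) + (norm (u - l))\<^sup>2"
        by (simp add: power2_norm_eq_inner inner_diff inner_commute)
      then have "ell / 2 * (norm (u - l'))\<^sup>2
          = ell / 2 * (norm (l - l'))\<^sup>2 + ell * ((u - l) \<bullet> (l - l')) + ell / 2 * (norm (u - l))\<^sup>2"
        by (simp only: distrib_left)
      moreover have "0 \<le> ell / 2 * (norm (u - l))\<^sup>2" using ell by simp
      moreover have "t + (u - l) \<bullet> (w - ell *\<^sub>R (l - l')) \<le> s" using t(2)[of u] real by simp
      moreover have "(u - l) \<bullet> (w - ell *\<^sub>R (l - l')) = u \<bullet> w - l \<bullet> w - ell * ((u - l) \<bullet> (l - l'))"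
        by (simp only: inner_diff_right[of _ w] inner_diff_left[of u l w] inner_scaleR_right)
      ultimately have "u \<bullet> w - s - ell / 2 * (norm (u - l'))\<^sup>2 \<le> l \<bullet> w - t - ell / 2 * (norm (l - l'))\<^sup>2"
        by linarith
      then show ?thesis using real t(1) by simp
    qed (use t(2)[of u] in auto)
  next
    have "ereal (l \<bullet> w) - g l - ereal (ell / 2 * (norm (l - l'))\<^sup>2)
        \<le> (SUP u. ereal (u \<bullet> w) - g u - ereal (ell / 2 * (norm (u - l'))\<^sup>2))"
      by (rule SUP_upper) simp
    then show "ereal (l \<bullet> w - real_of_ereal (g l) - ell / 2 * (norm (l - l'))\<^sup>2)
        \<le> (SUP u. ereal (u \<bullet> w) - g u - ereal (ell / 2 * (norm (u - l'))\<^sup>2))"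
      by (simp add: t(1))
  qed
qed

lemma prox_eqI:
  assumes sub: "subgradient g (w - ell *\<^sub>R (l - l')) l" and ell: "0 < ell"
  shows "prox (\<lambda>u. g u / ereal ell) (l' + (1 / ell) *\<^sub>R w) = l"
proof -
  define x where "x = l' + (1 / ell) *\<^sub>R w"
  define p where "p u = g u / ereal ell + ereal ((norm (x - u))\<^sup>2 / 2)" for u
  obtain t where t: "g l = ereal t" "\<And>u. ereal (t + (u - l) \<bullet> (w - ell *\<^sub>R (l - l'))) \<le> g u"
    using sub unfolding subgradient_def by blast
  have wx: "w - ell *\<^sub>R (l - l') = ell *\<^sub>R (x - l)"
    using ell by (simp add: x_def algebra_simps)
  \<comment> \<open>Quadratic growth around \<open>l\<close> makes it the only minimiser; uniqueness
    matters because \<open>arg_min\<close> is a choice.\<close>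
  have strict: "p l + ereal ((norm (u - l))\<^sup>2 / 2) \<le> p u" for u
  proof (cases "g u")
    case (real s)
    have "(norm (x - u))\<^sup>2 = (norm (x - l))\<^sup>2 - 2 * ((u - l) \<bullet> (x - l)) + (norm (u - l))\<^sup>2"
      by (simp add: power2_norm_eq_inner inner_diff inner_commute)
    moreover have "t + ell * ((u - l) \<bullet> (x - l)) \<le> s" using t(2)[of u] real wx by simp
    then have "(t + ell * ((u - l) \<bullet> (x - l))) / ell \<le> s / ell" using ell by (intro divide_right_mono) auto
    then have "t / ell + (u - l) \<bullet> (x - l) \<le> s / ell" using ell by (simp add: add_divide_distrib)
    ultimately have "t / ell + (norm (x - l))\<^sup>2 / 2 + (norm (u - l))\<^sup>2 / 2 \<le> s / ell + (norm (x - u))\<^sup>2 / 2"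
      by linarith
    then show ?thesis using real t(1) ell by (simp add: p_def)
  next
    case PInf
    then show ?thesis using ell by (simp add: p_def divide_ereal_def)
  qed (use t(2)[of u] in auto)
  have le: "p l \<le> p u" for u
  proof -
    have "p l + 0 \<le> p l + ereal ((norm (u - l))\<^sup>2 / 2)" by (rule add_left_mono) simp
    then show ?thesis using strict[of u] by simp
  qed
  then have "p (arg_min p (\<lambda>_. True)) = p l" by (intro arg_min_equality) auto
  moreover have "p l = ereal (t / ell + (norm (x - l))\<^sup>2 / 2)" using t(1) ell by (simp add: p_def)
  ultimately have "arg_min p (\<lambda>_. True) = l" using strict[of "arg_min p (\<lambda>_. True)"] by simp
  then show ?thesis by (simp add: prox_def p_def[abs_def] x_def)
qed


section \<open>Singular values, strong duality and the proximal step\<close>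

text \<open>Otherwise the simplifier would replace \<open>transpose A *v y\<close> by
  \<open>y v* A\<close>.\<close>

declare transpose_matrix_vector [simp del]

lemma inner_transpose:
  fixes A :: "real^'n^'m"
  shows "x \<bullet> (transpose A *v y) = (A *v x) \<bullet> y"
  by (metis dot_lmul_matrix inner_commute transpose_matrix_vector)

lemma norm_matrix_vector_le:
  fixes A :: "real^'n^'m"
  assumes "onorm ((*v) A) \<le> c"
  shows "norm (A *v x) \<le> c * norm x"
  using onorm[OF matrix_vector_mul_bounded_linear, of A x] assms mult_right_mono[OF assms norm_ge_zero[of x]]
  by linarith

lemma norm_transpose_vector_le:
  fixes A :: "real^'n^'m"
  assumes "onorm ((*v) A) \<le> c"
  shows "norm (transpose A *v y) \<le> c * norm y"
proof (cases "transpose A *v y = 0")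
  case False
  define u where "u = transpose A *v y"
  have "norm u * norm u = (A *v u) \<bullet> y"
    by (metis inner_transpose power2_eq_square power2_norm_eq_inner u_def)
  also have "\<dots> \<le> norm (A *v u) * norm y" by (rule norm_cauchy_schwarz)
  also have "\<dots> \<le> (c * norm u) * norm y"
    using norm_matrix_vector_le[OF assms] by (intro mult_right_mono) auto
  finally have "norm u * norm u \<le> norm u * (c * norm y)" by (simp add: mult_ac)
  then show ?thesis using False by (simp add: u_def)
next
  case True
  have "0 \<le> c" using onorm_pos_le[OF matrix_vector_mul_bounded_linear[of A]] assms by linarith
  then show ?thesis using True by simp
qed

text \<open>A minimiser of the Rayleigh quotient of \<open>A A\<^sup>T\<close> over the unit sphere is an eigenvector.\<close>

lemma min_singular_value_le:
  fixes A :: "real^'n^'m"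
  shows "min_singular_value A * norm y \<le> norm (transpose A *v y)"
proof -
  let ?T = "\<lambda>y. transpose A *v y"
  have "continuous_on (sphere 0 1) (\<lambda>y. norm (?T y))"
    by (intro continuous_on_norm linear_continuous_on) auto
  moreover obtain u :: "real^'m" where "norm u = 1" using vector_choose_size[of 1] by auto
  then have "sphere (0 :: real^'m) 1 \<noteq> {}" by auto
  ultimately obtain v where v: "norm v = 1" "\<And>y. norm y = 1 \<Longrightarrow> norm (?T v) \<le> norm (?T y)"
    using continuous_attains_inf[OF compact_sphere, of 0 1 "\<lambda>y. norm (?T y)"] by auto
  define \<sigma> where "\<sigma> = norm (?T v)"
  have min: "\<sigma> * norm y \<le> norm (?T y)" for y
  proof (cases "y = 0")
    case False
    have "\<sigma> \<le> norm (?T ((1 / norm y) *\<^sub>R y))" unfolding \<sigma>_def by (rule v(2)) (simp add: False)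
    then show ?thesis using False by (simp add: matrix_vector_mult_scaleR field_simps)
  qed simp
  \<comment> \<open>The residual of the eigenvalue equation. Moving \<open>v\<close> along
    \<open>d\<close> in the inequality \<open>min\<close> leaves \<open>2 * (d \<bullet> d)\<close>
    as first-order term, which must therefore vanish.\<close>
  define d where "d = \<sigma>\<^sup>2 *\<^sub>R v - A *v (?T v)"
  have "r * (2 * (d \<bullet> d)) \<le> r\<^sup>2 * ((norm (?T d))\<^sup>2)" for r :: real
  proof -
    have "(\<sigma> * norm (v + r *\<^sub>R d))\<^sup>2 \<le> (norm (?T (v + r *\<^sub>R d)))\<^sup>2"
      using min by (intro power_mono) (auto simp: \<sigma>_def)
    moreover have "(norm (v + r *\<^sub>R d))\<^sup>2 = 1 + 2 * r * (d \<bullet> v) + r\<^sup>2 * (d \<bullet> d)"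
    proof -
      have "v \<bullet> v = 1" using v(1) by (simp add: norm_eq_1)
      then show ?thesis unfolding power2_norm_eq_inner
        by (simp add: inner_add inner_commute power2_eq_square[of r] algebra_simps)
    qed
    moreover have "(norm (?T (v + r *\<^sub>R d)))\<^sup>2
        = \<sigma>\<^sup>2 + 2 * r * (d \<bullet> (A *v ?T v)) + r\<^sup>2 * (norm (?T d))\<^sup>2"
    proof -
      have "?T d \<bullet> ?T v = d \<bullet> (A *v ?T v)" by (metis inner_transpose inner_commute)
      then show ?thesis unfolding \<sigma>_def power2_norm_eq_inner
        by (simp add: matrix_vector_right_distrib matrix_vector_mult_scaleR inner_add inner_commute
            power2_eq_square[of r] algebra_simps)
    qed
    moreover have "d \<bullet> d = \<sigma>\<^sup>2 * (d \<bullet> v) - d \<bullet> (A *v ?T v)"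
      by (subst (2) d_def) (simp add: inner_diff_right)
    then have "2 * r * (d \<bullet> d) = 2 * r * (\<sigma>\<^sup>2 * (d \<bullet> v) - d \<bullet> (A *v ?T v))"
      by (rule arg_cong)
    then have "2 * r * (d \<bullet> d) = \<sigma>\<^sup>2 * (2 * r * (d \<bullet> v)) - 2 * r * (d \<bullet> (A *v ?T v))"
      by (simp only: right_diff_distrib mult.left_commute)
    moreover have "0 \<le> \<sigma>\<^sup>2 * (r\<^sup>2 * (d \<bullet> d))" by simp
    ultimately show ?thesis by (simp only: power_mult_distrib distrib_left mult_1_right)
  qed
  then have "2 * (d \<bullet> d) \<le> 0" by (rule linear_le_quadratic_imp_nonpos)
  then have "d = 0" by (metis inner_gt_zero_iff mult_le_0_iff not_le zero_less_numeral)
  then have "(A ** transpose A) *v v = \<sigma>\<^sup>2 *\<^sub>R v" by (simp add: d_def matrix_vector_mul_assoc)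
  moreover have "v \<noteq> 0" "0 \<le> \<sigma>" using v(1) by (auto simp: \<sigma>_def)
  ultimately have "\<sigma> \<in> singular_values A" by (auto simp: singular_values_def)
  then have "min_singular_value A \<le> \<sigma>"
    unfolding min_singular_value_def by (rule cInf_lower) (auto simp: singular_values_def bdd_below_def)
  then show ?thesis using min[of y] mult_right_mono[OF _ norm_ge_zero] order_trans by blast
qed

section \<open>Optimality conditions of the composite problem\<close>

locale composite =
  fixes f :: "real^'n \<Rightarrow> real" and h :: "real^'m \<Rightarrow> ereal"
    and A :: "real^'n^'m" and b :: "real^'m"
    and Lf \<mu>f LA \<mu>A :: real and xstar :: "real^'n" and lamstar :: "real^'m"
  assumes f_smooth: "smooth_fun Lf f"
    and mu_f: "0 < \<mu>f" and f_sc: "strongly_convex \<mu>f f"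
    and h_pcc: "proper_closed_convex h"
    and A_rank: "rank A = CARD('m)"
    and A_norm: "onorm ((*v) A) \<le> LA"
    and mu_A: "0 < \<mu>A" and A_sing: "\<mu>A \<le> min_singular_value A"
    and primal_opt: "primal_obj f h A b xstar \<le> primal_obj f h A b x"
    and dual_opt: "dual_obj f h A b lam \<le> dual_obj f h A b lamstar"
begin

lemma f_tangent: "f y \<ge> f x + (y - x) \<bullet> grad f x + \<mu>f / 2 * (norm (y - x))\<^sup>2"
  by (rule strongly_convex_above_gderiv[OF f_sc smooth_fun_gderiv[OF f_smooth]])

sublocale f: agd f Lf \<mu>f 0
  using f_smooth mu_f f_tangent by unfold_locales

lemma norm_transpose_ge: "\<mu>A * norm y \<le> norm (transpose A *v y)"
  using mult_right_mono[OF A_sing norm_ge_zero[of y]] min_singular_value_le[of A y] by linarith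

lemma mu_A_le: "\<mu>A \<le> LA"
proof -
  obtain u :: "real^'m" where "norm u = 1" using vector_choose_size[of 1] by auto
  then show ?thesis using norm_transpose_ge[of u] norm_transpose_vector_le[OF A_norm, of u] by simp
qed

lemma A_solve: obtains x where "A *v x = z"
  using A_rank unfolding full_rank_surjective by (metis surjD)

text \<open>Surjectivity of \<open>A\<close> reaches the domain of \<open>h\<close>, so the primal
  objective is finite somewhere and hence at its minimiser.\<close>

lemma h_xstar: obtains t where "h (A *v xstar - b) = ereal t"
proof -
  obtain z where z: "h z \<noteq> \<infinity>" using h_pcc by (auto simp: proper_closed_convex_def)
  obtain x where "A *v x = z + b" by (rule A_solve)
  then have "h (A *v xstar - b) \<noteq> \<infinity>"
    using primal_opt[of x] z unfolding primal_obj_def by auto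
  moreover have "h (A *v xstar - b) \<noteq> - \<infinity>" using h_pcc by (auto simp: proper_closed_convex_def)
  ultimately show ?thesis using that by (cases "h (A *v xstar - b)") auto
qed

text \<open>A step of length \<open>r\<close> from \<open>xstar\<close> towards \<open>x\<close>
  changes \<open>h\<close> at most linearly by convexity and \<open>f\<close> linearly up to a
  quadratic error by smoothness.\<close>

lemma primal_variational:
  assumes t: "h (A *v xstar - b) = ereal t" and s: "h (A *v x - b) = ereal s"
  shows "t - (x - xstar) \<bullet> grad f xstar \<le> s"
proof -
  define d where "d = x - xstar"
  have "r * (t - s - d \<bullet> grad f xstar) \<le> r\<^sup>2 * (Lf / 2 * (norm d)\<^sup>2)" if r: "0 < r" "r \<le> 1" for r
  proof -
    have "(A *v xstar - b, t) \<in> epigraph h" "(A *v x - b, s) \<in> epigraph h"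
      by (auto simp: epigraph_def t s)
    then have "(1 - r) *\<^sub>R (A *v xstar - b, t) + r *\<^sub>R (A *v x - b, s) \<in> epigraph h"
      using r h_pcc by (intro convexD) (auto simp: proper_closed_convex_def)
    moreover have "(1 - r) *\<^sub>R (A *v xstar - b) + r *\<^sub>R (A *v x - b) = A *v (xstar + r *\<^sub>R d) - b"
      by (simp add: d_def matrix_vector_right_distrib matrix_vector_mult_scaleR
          matrix_vector_mult_diff_distrib algebra_simps)
    ultimately have "h (A *v (xstar + r *\<^sub>R d) - b) \<le> ereal ((1 - r) * t + r * s)"
      by (simp add: epigraph_def)
    then have "ereal (f xstar + t) \<le> ereal (f (xstar + r *\<^sub>R d) + ((1 - r) * t + r * s))"
      using primal_opt[of "xstar + r *\<^sub>R d"] unfolding primal_obj_def t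
      by (cases "h (A *v (xstar + r *\<^sub>R d) - b)") auto
    moreover have "f (xstar + r *\<^sub>R d) \<le> f xstar + r * (d \<bullet> grad f xstar) + r\<^sup>2 * (Lf / 2 * (norm d)\<^sup>2)"
      using smooth_fun_upper[OF f_smooth, of "xstar + r *\<^sub>R d" xstar]
      by (simp add: power_mult_distrib mult_ac)
    ultimately show ?thesis by (simp add: algebra_simps)
  qed
  then have "t - s - d \<bullet> grad f xstar \<le> 0" by (rule linear_le_quadratic_imp_nonpos)
  then show ?thesis by (simp add: d_def)
qed

text \<open>Full row rank makes a separation argument unnecessary: primal optimality forces
  \<open>\<nabla>f(x\<^sup>\<star>)\<close> to be orthogonal to the kernel of \<open>A\<close>, hence to lie in the range of \<open>A\<^sup>T\<close>.\<close>

lemma multiplier_exists: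
  obtains l where "grad f xstar = - (transpose A *v l)" "subgradient h l (A *v xstar - b)"
proof -
  obtain t where t: "h (A *v xstar - b) = ereal t" by (rule h_xstar)
  have ker: "0 \<le> v \<bullet> grad f xstar" if "A *v v = 0" for v
    using primal_variational[OF t, of "xstar + v" t] that by (simp add: t matrix_vector_right_distrib)
  have ker0: "v \<bullet> grad f xstar = 0" if "A *v v = 0" for v
    using ker[OF that] ker[of "- v"] that by (simp add: linear_neg[OF matrix_vector_mul_linear])
  have inj: "y = 0" if "transpose A *v y = 0" for y
    using norm_transpose_ge[of y] that mu_A by (simp add: mult_le_0_iff)
  have "surj (\<lambda>y. (A ** transpose A) *v y)"
  proof -
    have "inj ((*v) (A ** transpose A))"
    proof (rule linear_injective_0[THEN iffD2, rule_format])
      fix y assume "(A ** transpose A) *v y = 0"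
      then have "(A *v (transpose A *v y)) \<bullet> y = 0" by (simp add: matrix_vector_mul_assoc)
      then have "transpose A *v y = 0" using inner_transpose[of "transpose A *v y" A y] by simp
      then show "y = 0" by (rule inj)
    qed simp
    then show ?thesis by (intro linear_injective_imp_surjective) auto
  qed
  then obtain k where "(A ** transpose A) *v k = - (A *v grad f xstar)" by (metis surjD)
  then have k: "A *v (transpose A *v k) = - (A *v grad f xstar)" by (simp add: matrix_vector_mul_assoc)
  \<comment> \<open>The kernel component of the gradient: \<open>k\<close> solves the normal
    equations, so \<open>w\<close> lies in the kernel of \<open>A\<close> and is orthogonal to the
    range of \<open>transpose A\<close>.\<close>
  define w where "w = grad f xstar + transpose A *v k"
  have w: "A *v w = 0" by (simp add: w_def matrix_vector_right_distrib k)
  have "w \<bullet> w = w \<bullet> grad f xstar + (A *v w) \<bullet> k"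
    by (metis inner_add_right inner_transpose w_def)
  then have "w = 0" using ker0[OF w] w by simp
  then have k: "grad f xstar = - (transpose A *v k)" by (simp add: w_def eq_neg_iff_add_eq_0)
  have "ereal (t + (z - (A *v xstar - b)) \<bullet> k) \<le> h z" for z
  proof -
    obtain x where x: "A *v x = z + b" by (rule A_solve)
    have "(x - xstar) \<bullet> (transpose A *v k) = (z - (A *v xstar - b)) \<bullet> k"
      by (simp add: inner_transpose matrix_vector_mult_diff_distrib x diff_diff_eq2)
    then have "ereal (t + (z - (A *v xstar - b)) \<bullet> k) \<le> ereal s" if "h z = ereal s" for s
      using primal_variational[OF t, of x s] that x k by simp
    moreover have "h z \<noteq> - \<infinity>" using h_pcc by (auto simp: proper_closed_convex_def)
    ultimately show ?thesis by (cases "h z") auto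
  qed
  then show ?thesis using that[OF k] t unfolding subgradient_def by blast
qed

text \<open>The multiplier \<open>l\<close> closes the duality gap, so the dual value at
  \<open>lamstar\<close> is at least the primal optimum. This makes \<open>xstar\<close> a minimiser
  of the Lagrangian at \<open>lamstar\<close>, and injectivity of \<open>transpose A\<close>
  identifies \<open>lamstar\<close> with \<open>l\<close>.\<close>

lemma kkt: "grad f xstar = - (transpose A *v lamstar)" "subgradient h lamstar (A *v xstar - b)"
proof -
  obtain l where l: "grad f xstar = - (transpose A *v l)" "subgradient h l (A *v xstar - b)"
    by (rule multiplier_exists)
  obtain t where t: "h (A *v xstar - b) = ereal t" by (rule h_xstar)
  let ?f = "\<lambda>x. ereal (f x)"
  have "subgradient ?f (grad f xstar) xstar"
    unfolding subgradient_def using f.tangent0[of xstar] by auto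
  then have "conjugate ?f (- (transpose A *v l)) = ereal (- ((A *v xstar) \<bullet> l) - f xstar)"
    using subgradient_conjugate(2)[of ?f] l(1) by (simp add: inner_transpose)
  moreover have "conjugate h l = ereal ((A *v xstar - b) \<bullet> l - t)"
    using subgradient_conjugate(2)[OF l(2)] t by simp
  ultimately have dl: "dual_obj f h A b l = ereal (f xstar + t)"
    unfolding dual_obj_def by (simp add: inner_diff_left)
  have gap: "f xstar + xstar \<bullet> (transpose A *v lamstar) \<le> f x + x \<bullet> (transpose A *v lamstar)" for x
  proof -
    have 1: "ereal (- (x \<bullet> (transpose A *v lamstar)) - f x) \<le> conjugate ?f (- (transpose A *v lamstar))"
      unfolding conjugate_def by (rule SUP_upper2[of x]) auto
    have 2: "ereal ((A *v xstar - b) \<bullet> lamstar - t) \<le> conjugate h lamstar"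
      unfolding conjugate_def by (rule SUP_upper2[of "A *v xstar - b"]) (auto simp: t)
    have 3: "ereal (f xstar + t) \<le> dual_obj f h A b lamstar" using dual_opt[of l] dl by simp
    show ?thesis
      using 1 2 3 unfolding dual_obj_def
      by (cases "conjugate ?f (- (transpose A *v lamstar))"; cases "conjugate h lamstar")
        (auto simp: inner_diff_left inner_transpose)
  qed
  define g where "g = grad f xstar + transpose A *v lamstar"
  have "r * (g \<bullet> g) \<le> r\<^sup>2 * (Lf / 2 * (g \<bullet> g))" for r
  proof -
    have "f (xstar - r *\<^sub>R g) \<le> f xstar - r * (g \<bullet> grad f xstar) + r\<^sup>2 * (Lf / 2 * (g \<bullet> g))"
      using smooth_fun_upper[OF f_smooth, of "xstar - r *\<^sub>R g" xstar]
      by (simp add: power_mult_distrib power2_norm_eq_inner mult_ac)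
    moreover have "g \<bullet> g = g \<bullet> grad f xstar + g \<bullet> (transpose A *v lamstar)"
      by (simp add: g_def inner_add_right)
    then have "r * (g \<bullet> g) = r * (g \<bullet> grad f xstar) + r * (g \<bullet> (transpose A *v lamstar))"
      by (simp add: distrib_left)
    ultimately show ?thesis using gap[of "xstar - r *\<^sub>R g"] by (simp add: inner_diff_left)
  qed
  then have "g \<bullet> g \<le> 0" by (rule linear_le_quadratic_imp_nonpos)
  then have "g = 0" by (metis inner_gt_zero_iff not_le)
  then show 1: "grad f xstar = - (transpose A *v lamstar)" by (simp add: g_def eq_neg_iff_add_eq_0)
  have "transpose A *v (l - lamstar) = 0"
    using 1 l(1) by (simp add: matrix_vector_mult_diff_distrib)
  then have "l = lamstar"
    using norm_transpose_ge[of "l - lamstar"] mu_A by (simp add: mult_le_0_iff)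
  then show "subgradient h lamstar (A *v xstar - b)" using l(2) by simp
qed

end

section \<open>The inner objective and the exact proximal step\<close>

context composite
begin

text \<open>Both the dual update for the residual \<open>w\<close> and the maximiser in
  \<open>Psi\<close> at a point with this residual; \<open>lam_prox_subgradient\<close> is the
  optimality condition of either problem.\<close>

definition lam_prox :: "real \<Rightarrow> real^'m \<Rightarrow> real^'m \<Rightarrow> real^'m" where
  "lam_prox ell l' w = prox (\<lambda>u. conjugate h u / ereal ell) (l' + (1 / ell) *\<^sub>R w)"

lemma kkt_conjugate: "subgradient (conjugate h) (A *v xstar - b) lamstar"
  by (rule subgradient_conjugate(1)[OF kkt(2)])

lemma lam_prox_subgradient:
  assumes ell: "0 < ell"
  shows "subgradient (conjugate h) (w - ell *\<^sub>R (lam_prox ell l' w - l')) (lam_prox ell l' w)"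
proof -
  obtain t where t: "h (A *v xstar - b) = ereal t" by (rule h_xstar)
  have "proper_closed_convex (conjugate h)"
    by (rule proper_closed_convex_conjugate[of h "A *v xstar - b" lamstar])
      (use h_pcc t subgradient_conjugate(2)[OF kkt(2)] in \<open>auto simp: proper_closed_convex_def\<close>)
  moreover have "ereal (u \<bullet> (A *v xstar - b) - t) \<le> conjugate h u" for u
    unfolding conjugate_def by (rule SUP_upper2[of "A *v xstar - b"]) (auto simp: t inner_commute)
  ultimately obtain l where l: "subgradient (conjugate h) (w - ell *\<^sub>R (l - l')) l"
    using ell by (rule proximal_point_exists)
  then show ?thesis unfolding lam_prox_def prox_eqI[OF l ell] .
qed

text \<open>Monotonicity of the subgradients of the conjugate; the proximal term contributes strong
  monotonicity with modulus \<open>ell\<close>.\<close>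

lemma lam_prox_lipschitz:
  assumes ell: "0 < ell"
  shows "norm (lam_prox ell l' w - lam_prox ell l' w') \<le> norm (w - w') / ell"
proof -
  define d where "d = lam_prox ell l' w - lam_prox ell l' w'"
  have "(w - ell *\<^sub>R (lam_prox ell l' w - l') - (w' - ell *\<^sub>R (lam_prox ell l' w' - l'))) \<bullet> d \<ge> 0"
    unfolding d_def by (rule subgradient_monotone) (rule lam_prox_subgradient[OF ell])+
  also have "w - ell *\<^sub>R (lam_prox ell l' w - l') - (w' - ell *\<^sub>R (lam_prox ell l' w' - l')) = (w - w') - ell *\<^sub>R d"
    by (simp add: d_def algebra_simps)
  finally have "ell * (norm d * norm d) \<le> (w - w') \<bullet> d"
    by (simp add: inner_diff_left power2_norm_eq_inner[symmetric] power2_eq_square)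
  also have "\<dots> \<le> norm (w - w') * norm d" by (rule norm_cauchy_schwarz)
  finally have "(ell * norm d) * norm d \<le> norm (w - w') * norm d" by (simp add: mult_ac)
  then have "ell * norm d \<le> norm (w - w')" by (cases "d = 0") auto
  then show ?thesis using ell by (simp add: d_def field_simps)
qed

abbreviation Psi :: "real \<Rightarrow> real^'m \<Rightarrow> real^'n \<Rightarrow> real" where
  "Psi \<equiv> ppa_Psi f h A b"

text \<open>Danskin's formula, confirmed as the gradient in \<open>Psi_gderiv\<close>.\<close>

definition grad_Psi :: "real \<Rightarrow> real^'m \<Rightarrow> real^'n \<Rightarrow> real^'n" where
  "grad_Psi ell l' x = grad f x + transpose A *v lam_prox ell l' (A *v x - b)"

text \<open>The max-part is a supremum of affine functions of the residual, and the maximiser at one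
  residual stays a candidate at another, which gives its slope; strong convexity comes from
  \<open>f\<close>.\<close>

lemma Psi_tangent:
  assumes ell: "0 < ell"
  shows "Psi ell l' y \<ge> Psi ell l' x + (y - x) \<bullet> grad_Psi ell l' x + \<mu>f / 2 * (norm (y - x))\<^sup>2"
proof -
  define G where "G w = (SUP u. ereal (u \<bullet> w) - conjugate h u - ereal (ell / 2 * (norm (u - l'))\<^sup>2))" for w
  let ?l = "lam_prox ell l'"
  have Gval: "G w = ereal (?l w \<bullet> w - real_of_ereal (conjugate h (?l w)) - ell / 2 * (norm (?l w - l'))\<^sup>2)" for w
    unfolding G_def using lam_prox_subgradient[OF ell] ell by (intro proximal_value) auto
  have G: "real_of_ereal (G w) + ?l w \<bullet> (w' - w) \<le> real_of_ereal (G w')" for w w'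
  proof -
    obtain t where t: "conjugate h (?l w) = ereal t"
      using lam_prox_subgradient[OF ell, of w l'] unfolding subgradient_def by blast
    have "ereal (?l w \<bullet> w') - conjugate h (?l w) - ereal (ell / 2 * (norm (?l w - l'))\<^sup>2) \<le> G w'"
      unfolding G_def by (rule SUP_upper) simp
    then show ?thesis unfolding Gval t by (simp add: inner_diff_right)
  qed
  have Psi: "Psi ell l' x = f x + real_of_ereal (G (A *v x - b))" for x
    by (simp add: ppa_Psi_def G_def)
  have "?l (A *v x - b) \<bullet> ((A *v y - b) - (A *v x - b)) = (y - x) \<bullet> (transpose A *v ?l (A *v x - b))"
    by (simp add: inner_transpose matrix_vector_mult_diff_distrib inner_commute)
  then show ?thesis
    using G[of "A *v x - b" "A *v y - b"] f_tangent[of x y]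
    unfolding Psi grad_Psi_def inner_add_right by linarith
qed

lemma LA_pos: "0 < LA" using mu_A mu_A_le by simp

lemma grad_Psi_lipschitz:
  assumes ell: "0 < ell"
  shows "norm (grad_Psi ell l' x - grad_Psi ell l' y) \<le> ppa_L Lf LA ell * norm (x - y)"
proof -
  let ?d = "lam_prox ell l' (A *v x - b) - lam_prox ell l' (A *v y - b)"
  have "norm ?d \<le> norm ((A *v x - b) - (A *v y - b)) / ell" by (rule lam_prox_lipschitz[OF ell])
  also have "(A *v x - b) - (A *v y - b) = A *v (x - y)" by (simp add: matrix_vector_mult_diff_distrib)
  also have "norm (A *v (x - y)) / ell \<le> LA * norm (x - y) / ell"
    using norm_matrix_vector_le[OF A_norm] ell by (intro divide_right_mono) auto
  finally have "LA * norm ?d \<le> LA * (LA * norm (x - y) / ell)"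
    using LA_pos by (intro mult_left_mono) auto
  then have "norm (transpose A *v ?d) \<le> LA\<^sup>2 / ell * norm (x - y)"
    using norm_transpose_vector_le[OF A_norm, of ?d] by (simp add: power2_eq_square)
  moreover have "grad_Psi ell l' x - grad_Psi ell l' y = (grad f x - grad f y) + transpose A *v ?d"
    by (simp add: grad_Psi_def matrix_vector_mult_diff_distrib)
  ultimately show ?thesis
    using smooth_fun_lipschitz[OF f_smooth, of x y]
      norm_triangle_ineq[of "grad f x - grad f y" "transpose A *v ?d"]
    by (simp add: ppa_L_def distrib_right)
qed

lemma Psi_gderiv:
  assumes ell: "0 < ell"
  shows "GDERIV (Psi ell l') x :> grad_Psi ell l' x"
proof (rule tangent_lipschitz_imp_gderiv)
  fix x y :: "real^'n"
  have "0 \<le> \<mu>f / 2 * (norm (y - x))\<^sup>2" using mu_f by simp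
  then show "Psi ell l' y \<ge> Psi ell l' x + (y - x) \<bullet> grad_Psi ell l' x"
    using Psi_tangent[OF ell, of l' x y] by linarith
qed (rule grad_Psi_lipschitz[OF ell])

lemma grad_Psi_eq: "0 < ell \<Longrightarrow> grad (Psi ell l') = grad_Psi ell l'"
  by (rule ext, rule grad_eq, rule Psi_gderiv)

lemma agd_Psi:
  assumes ell: "0 < ell"
  shows "agd (Psi ell l') (ppa_L Lf LA ell) \<mu>f"
proof
  have "0 \<le> ppa_L Lf LA ell" using f.L_pos ell by (simp add: ppa_L_def)
  then show "smooth_fun (ppa_L Lf LA ell) (Psi ell l')"
    unfolding smooth_fun_def grad_Psi_eq[OF ell] lipschitz_on_def
    using Psi_gderiv[OF ell] grad_Psi_lipschitz[OF ell] by (auto simp: dist_norm)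
qed (use mu_f Psi_tangent[OF ell] in \<open>auto simp: grad_Psi_eq[OF ell]\<close>)

lemma Psi_minimizer:
  assumes ell: "0 < ell"
  obtains xs where "grad (Psi ell l') xs = 0"
proof -
  interpret p: agd "Psi ell l'" "ppa_L Lf LA ell" \<mu>f 0 by (rule agd_Psi[OF ell])
  show ?thesis using strongly_convex_minimizer[OF p.mu_pos p.smooth p.tangent] that by blast
qed

text \<open>One exact proximal step contracts the dual distance, because the dual function is
  \<open>\<mu>\<^sub>\<Phi>\<close>-strongly concave: \<open>\<nabla>f\<close> is cocoercive and \<open>A\<^sup>T\<close> is bounded below by \<open>\<mu>\<^sub>A\<close>.\<close>

lemma exact_step_dual:
  assumes ell: "0 < ell" and xs: "grad (Psi ell l') xs = 0"
  defines "ls \<equiv> lam_prox ell l' (A *v xs - b)"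
  shows "(mu_Phi Lf \<mu>A + ell) * norm (ls - lamstar) \<le> ell * norm (l' - lamstar)"
proof -
  define dx dl where "dx = xs - xstar" and "dl = ls - lamstar"
  have g: "grad f xs = - (transpose A *v ls)"
    using xs unfolding grad_Psi_eq[OF ell] grad_Psi_def ls_def by (simp add: eq_neg_iff_add_eq_0)
  then have dg: "grad f xs - grad f xstar = - (transpose A *v dl)"
    by (simp add: kkt(1) dl_def matrix_vector_mult_diff_distrib)
  have "f xs \<ge> f xstar + dx \<bullet> grad f xstar + (norm (grad f xs - grad f xstar))\<^sup>2 / (2 * Lf)"
    "f xstar \<ge> f xs + (- dx) \<bullet> grad f xs + (norm (grad f xs - grad f xstar))\<^sup>2 / (2 * Lf)"
    using smooth_convex_cocoercive[OF f_smooth f.L_pos f.tangent0, where x = xstar and y = xs]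
      smooth_convex_cocoercive[OF f_smooth f.L_pos f.tangent0, where x = xs and y = xstar]
    by (simp_all add: dx_def norm_minus_commute)
  then have "(norm (grad f xs - grad f xstar))\<^sup>2 / Lf \<le> dx \<bullet> (grad f xs - grad f xstar)"
    by (simp add: inner_diff_right)
  then have co: "(norm (transpose A *v dl))\<^sup>2 / Lf \<le> - ((A *v dx) \<bullet> dl)"
    by (simp add: dg inner_transpose)
  have "(\<mu>A * norm dl)\<^sup>2 / Lf \<le> (norm (transpose A *v dl))\<^sup>2 / Lf"
    using norm_transpose_ge[of dl] mu_A f.L_pos by (intro divide_right_mono power_mono) auto
  then have 1: "mu_Phi Lf \<mu>A * (norm dl)\<^sup>2 \<le> - ((A *v dx) \<bullet> dl)"
    using co by (simp add: mu_Phi_def power_mult_distrib)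
  \<comment> \<open>Monotonicity between the proximal point and the optimum. Adding the cocoercivity
    bound cancels the coupling term \<open>(A *v dx) \<bullet> dl\<close>.\<close>
  have "(A *v xs - b - ell *\<^sub>R (ls - l') - (A *v xstar - b)) \<bullet> (ls - lamstar) \<ge> 0"
    unfolding ls_def by (rule subgradient_monotone[OF lam_prox_subgradient[OF ell] kkt_conjugate])
  also have "A *v xs - b - ell *\<^sub>R (ls - l') - (A *v xstar - b) = A *v dx - ell *\<^sub>R dl + ell *\<^sub>R (l' - lamstar)"
    by (simp add: dx_def dl_def matrix_vector_mult_diff_distrib algebra_simps)
  finally have "ell * (norm dl)\<^sup>2 \<le> (A *v dx) \<bullet> dl + ell * ((l' - lamstar) \<bullet> dl)"
    by (simp add: dl_def[symmetric] inner_add_left inner_diff_left power2_norm_eq_inner)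
  also have "ell * ((l' - lamstar) \<bullet> dl) \<le> ell * (norm (l' - lamstar) * norm dl)"
    using ell by (intro mult_left_mono norm_cauchy_schwarz) auto
  finally have "((mu_Phi Lf \<mu>A + ell) * norm dl) * norm dl \<le> (ell * norm (l' - lamstar)) * norm dl"
    using 1 by (simp add: power2_eq_square algebra_simps)
  then show ?thesis using ell by (cases "dl = 0") (auto simp: dl_def)
qed

text \<open>At both points the gradient of \<open>f\<close> is minus \<open>transpose A\<close>
  applied to the multiplier, and strong monotonicity of that gradient transfers dual distances to
  primal ones.\<close>

lemma exact_step_primal:
  assumes ell: "0 < ell" and xs: "grad (Psi ell l') xs = 0"
  defines "ls \<equiv> lam_prox ell l' (A *v xs - b)"
  shows "\<mu>f * norm (xs - xstar) \<le> LA * norm (ls - lamstar)"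
proof -
  define d where "d = xs - xstar"
  have "grad f xs = - (transpose A *v ls)"
    using xs unfolding grad_Psi_eq[OF ell] grad_Psi_def ls_def by (simp add: eq_neg_iff_add_eq_0)
  then have dg: "grad f xs - grad f xstar = - (transpose A *v (ls - lamstar))"
    by (simp add: kkt(1) matrix_vector_mult_diff_distrib)
  have "f xs \<ge> f xstar + d \<bullet> grad f xstar + \<mu>f / 2 * (norm d)\<^sup>2"
    "f xstar \<ge> f xs + (- d) \<bullet> grad f xs + \<mu>f / 2 * (norm d)\<^sup>2"
    using f_tangent[of xstar xs] f_tangent[of xs xstar] by (simp_all add: d_def norm_minus_commute)
  then have "\<mu>f * (norm d)\<^sup>2 \<le> d \<bullet> (grad f xs - grad f xstar)" by (simp add: inner_diff_right)
  also have "\<dots> \<le> norm d * norm (grad f xs - grad f xstar)" by (rule norm_cauchy_schwarz)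
  also have "\<dots> \<le> norm d * (LA * norm (ls - lamstar))"
    unfolding dg norm_minus_cancel by (intro mult_left_mono norm_transpose_vector_le A_norm) simp
  finally have "norm d * (\<mu>f * norm d) \<le> norm d * (LA * norm (ls - lamstar))"
    by (simp add: power2_eq_square mult_ac)
  then show ?thesis using LA_pos by (cases "d = 0") (auto simp: d_def)
qed

end


section \<open>Convergence and complexity of the outer iteration\<close>

locale inexact_ppa = composite f h A b Lf \<mu>f LA \<mu>A xstar lamstar
  for f :: "real^'n \<Rightarrow> real" and h :: "real^'m \<Rightarrow> ereal"
    and A :: "real^'n^'m" and b :: "real^'m"
    and Lf \<mu>f LA \<mu>A :: real and xstar :: "real^'n" and lamstar :: "real^'m" +
  fixes ell D :: real and x0 :: "real^'n" and lam0 :: "real^'m"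
  assumes ell_ge: "mu_Phi Lf \<mu>A \<le> ell" and D_pos: "0 < D"
    and D_star: "norm (x0 - xstar) + LA / Lf * norm (lam0 - lamstar) \<le> D"
begin

abbreviation xk :: "nat \<Rightarrow> real^'n" where "xk \<equiv> ppa_x f h A b Lf \<mu>f LA \<mu>A ell D x0 lam0"
abbreviation lamk :: "nat \<Rightarrow> real^'m" where "lamk \<equiv> ppa_lam f h A b Lf \<mu>f LA \<mu>A ell D x0 lam0"
abbreviation \<delta> :: "nat \<Rightarrow> real" where "\<delta> \<equiv> ppa_delta Lf \<mu>A ell D"

definition \<kappa>f :: real where "\<kappa>f = Lf / \<mu>f"
definition \<kappa>A :: real where "\<kappa>A = LA / \<mu>A"
definition q :: real where "q = mu_Phi Lf \<mu>A / ell"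
text \<open>\<open>q / 12\<close> is the \<open>ppa_rho\<close> of the algorithm, so
  \<open>s\<close> is the factor by which the inner accuracies shrink.\<close>

definition s :: real where "s = sqrt (1 - q / 12)"
definition \<kappa> :: real where "\<kappa> = ppa_L Lf LA ell / \<mu>f"

lemma mu_Phi_pos: "0 < mu_Phi Lf \<mu>A"
  using mu_A f.L_pos by (simp add: mu_Phi_def)

lemma ell_pos: "0 < ell" using mu_Phi_pos ell_ge by simp

lemma q: "0 < q" "q \<le> 1"
  using mu_Phi_pos ell_pos ell_ge by (simp_all add: q_def)

lemma kappas: "1 \<le> \<kappa>f" "1 \<le> \<kappa>A"
  using f.mu_le_L mu_A_le mu_f mu_A by (simp_all add: \<kappa>f_def \<kappa>A_def)

lemma kappas_ge_1: "1 \<le> \<kappa>A\<^sup>2 * \<kappa>f"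
  using mult_mono[of 1 "\<kappa>A\<^sup>2" 1 \<kappa>f] kappas by simp

lemma s: "1 - q / 12 \<le> s" "11 / 12 \<le> s" "s \<le> 1" "0 < s" "s\<^sup>2 = 1 - q / 12"
proof -
  have "sqrt ((1 - q / 12)\<^sup>2) \<le> sqrt (1 - q / 12)"
    using q by (intro real_sqrt_le_mono) (simp add: power2_eq_square mult_left_le)
  then show *: "1 - q / 12 \<le> s" using q by (simp add: s_def)
  then show "11 / 12 \<le> s" "0 < s" using q by linarith+
  show "s \<le> 1" "s\<^sup>2 = 1 - q / 12" using q by (simp_all add: s_def)
qed

lemma delta_eq: "\<delta> k = s ^ k * D"
proof -
  have "(1 - q / 12) powr (real k / 2) = ((1 - q / 12) powr (1 / 2)) powr real k"
    by (simp add: powr_powr)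
  also have "\<dots> = s ^ k" using q s(4) by (simp add: powr_half_sqrt powr_realpow s_def)
  finally show ?thesis by (simp add: ppa_delta_def ppa_rho_def q_def mult.commute)
qed

text \<open>For \<open>q \<le> 1\<close> an exact step contracts by at most
  \<open>1 - q / 2\<close>; adding \<open>5 / 12 * q\<close> gives exactly
  \<open>1 - q / 12\<close>, which is below \<open>s\<close>.\<close>

lemma contraction: "1 / (1 + q) \<le> s" "5 / 12 * q + 1 / (1 + q) \<le> s"
proof -
  have "1 / (1 + q) \<le> 1 - q / 2"
    using q mult_left_le[of q q] by (simp add: field_simps)
  then show "1 / (1 + q) \<le> s" "5 / 12 * q + 1 / (1 + q) \<le> s" using s(1) q by linarith+
qed

text \<open>The constant \<open>C\<close> is chosen so that \<open>(L\<^sub>A / \<ell>) \<delta>\<^sub>k\<^sub>+\<^sub>1 + C s\<^sup>k / (1 + q) \<le> C s\<^sup>k\<^sup>+\<^sup>1\<close>: the error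
  of the inner solver is absorbed by the gap between the contraction factor \<open>1 / (1 + q)\<close> of an exact
  step and the slower rate \<open>s\<close>. It does not depend on \<open>\<ell>\<close>, which keeps \<open>\<ell>\<close> out of the logarithms.\<close>

definition C :: real where "C = 12 / 5 * (D * LA / mu_Phi Lf \<mu>A)"

lemma C_pos: "0 < C"
  using D_pos LA_pos mu_Phi_pos by (simp add: C_def)

lemma C_eq: "LA / \<mu>f * C = 12 / 5 * (\<kappa>A\<^sup>2 * \<kappa>f) * D" "LA / ell * D = 5 / 12 * q * C"
  using mu_A f.L_pos ell_pos mu_f
  by (auto simp: C_def \<kappa>A_def \<kappa>f_def q_def mu_Phi_def field_simps power2_eq_square)

lemma inner_target:
  assumes lam: "norm (l' - lamstar) \<le> C * s ^ k"
    and xs: "grad (Psi ell l') xs = 0"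
  shows "norm (lam_prox ell l' (A *v xs - b) - lamstar) \<le> 1 / (1 + q) * (C * s ^ k)"
    and "norm (xs - xstar) \<le> 12 / 5 * (\<kappa>A\<^sup>2 * \<kappa>f) * (D * s ^ Suc k)"
proof -
  define ls where "ls = lam_prox ell l' (A *v xs - b)"
  have "(mu_Phi Lf \<mu>A + ell) * norm (ls - lamstar) \<le> ell * norm (l' - lamstar)"
    unfolding ls_def by (rule exact_step_dual[OF ell_pos xs])
  also have "\<dots> \<le> ell * (C * s ^ k)" using lam ell_pos by (intro mult_left_mono) auto
  also have "mu_Phi Lf \<mu>A + ell = ell * (1 + q)" using ell_pos by (simp add: q_def field_simps)
  finally have "(1 + q) * norm (ls - lamstar) \<le> C * s ^ k" using ell_pos by simp
  then show 1: "norm (lam_prox ell l' (A *v xs - b) - lamstar) \<le> 1 / (1 + q) * (C * s ^ k)"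
    using q by (simp add: ls_def[symmetric] field_simps)
  also have "\<dots> \<le> s * (C * s ^ k)"
    using contraction C_pos s by (intro mult_right_mono) auto
  finally have "LA * norm (ls - lamstar) \<le> LA * (s * (C * s ^ k))"
    using LA_pos by (simp add: ls_def)
  then have "\<mu>f * norm (xs - xstar) \<le> LA * (s * (C * s ^ k))"
    using exact_step_primal[OF ell_pos xs] by (simp add: ls_def)
  then have "norm (xs - xstar) \<le> (LA / \<mu>f * C) * s ^ Suc k"
    using mu_f by (simp add: field_simps)
  then show "norm (xs - xstar) \<le> 12 / 5 * (\<kappa>A\<^sup>2 * \<kappa>f) * (D * s ^ Suc k)"
    unfolding C_eq(1) by (simp add: mult_ac)
qed

text \<open>The step bound of \<open>agd_stop\<close> with
  \<open>R = 9 * \<kappa>A\<^sup>2 * \<kappa>f\<close>, the same for every outer step.\<close>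

definition N :: nat where
  "N = nat \<lceil>sqrt \<kappa> * ln (2 * \<kappa>\<^sup>2 * (9 * \<kappa>A\<^sup>2 * \<kappa>f)\<^sup>2)\<rceil>"

text \<open>Warm start: the previous iterate and the new inner minimiser both lie within a multiple
  of \<open>D * s ^ k\<close> of \<open>xstar\<close>, and \<open>\<delta> (Suc k)\<close> is
  smaller than this only by the factor \<open>s\<close>.\<close>

lemma inner_stop:
  assumes lam: "norm (l' - lamstar) \<le> C * s ^ k"
    and x: "norm (x - xstar) \<le> 4 * \<kappa>A\<^sup>2 * \<kappa>f * (D * s ^ k)"
  shows "agd_stop (Psi ell l') (ppa_L Lf LA ell) \<mu>f x (\<delta> (Suc k)) N"
proof -
  interpret p: agd "Psi ell l'" "ppa_L Lf LA ell" \<mu>f x by (rule agd_Psi[OF ell_pos])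
  obtain xs where xs: "grad (Psi ell l') xs = 0" by (rule Psi_minimizer[OF ell_pos])
  define E where "E = \<kappa>A\<^sup>2 * \<kappa>f * (D * s ^ k)"
  have E: "0 \<le> E" using kappas_ge_1 D_pos s by (simp add: E_def)
  have "norm (x - xs) \<le> norm (x - xstar) + norm (xs - xstar)"
    using norm_triangle_ineq4[of "x - xstar" "xs - xstar"] by simp
  also have "\<dots> \<le> 4 * E + 12 / 5 * s * E"
    using x inner_target(2)[OF lam xs] by (simp add: E_def mult_ac)
  also have "\<dots> \<le> 9 * s * E"
  proof -
    have "4 + 12 / 5 * s \<le> 9 * s" using s(2) by linarith
    then have "(4 + 12 / 5 * s) * E \<le> 9 * s * E" using E by (rule mult_right_mono)
    then show ?thesis by (simp add: distrib_right)
  qed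
  also have "\<dots> = 9 * \<kappa>A\<^sup>2 * \<kappa>f * \<delta> (Suc k)" by (simp add: delta_eq E_def)
  finally show ?thesis
    by (intro p.agd_stop[OF xs, where R = "9 * \<kappa>A\<^sup>2 * \<kappa>f"])
      (use kappas D_pos s in \<open>auto simp: delta_eq N_def \<kappa>_def real_nat_ceiling_ge\<close>)
qed

lemma inner_output:
  assumes lam: "norm (l' - lamstar) \<le> C * s ^ k"
    and halts: "agd_halts (Psi ell l') (ppa_L Lf LA ell) \<mu>f x (\<delta> (Suc k))"
  defines "y \<equiv> agd_out (Psi ell l') (ppa_L Lf LA ell) \<mu>f x (\<delta> (Suc k))"
  shows "norm (lam_prox ell l' (A *v y - b) - lamstar) \<le> C * s ^ Suc k"
    and "norm (y - xstar) \<le> 4 * \<kappa>A\<^sup>2 * \<kappa>f * (D * s ^ Suc k)"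
proof -
  interpret p: agd "Psi ell l'" "ppa_L Lf LA ell" \<mu>f x by (rule agd_Psi[OF ell_pos])
  obtain xs where xs: "grad (Psi ell l') xs = 0" by (rule Psi_minimizer[OF ell_pos])
  define ls where "ls = lam_prox ell l' (A *v xs - b)"
  have y: "norm (y - xs) \<le> s ^ Suc k * D"
    unfolding y_def using p.agd_out_dist[OF xs halts] by (simp add: delta_eq)
  have "norm (y - xstar) \<le> norm (y - xs) + norm (xs - xstar)"
    using norm_triangle_ineq[of "y - xs" "xs - xstar"] by simp
  also have "\<dots> \<le> (1 + 12 / 5 * (\<kappa>A\<^sup>2 * \<kappa>f)) * (D * s ^ Suc k)"
    using y inner_target(2)[OF lam xs] by (simp add: algebra_simps)
  also have "\<dots> \<le> 4 * \<kappa>A\<^sup>2 * \<kappa>f * (D * s ^ Suc k)"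
    using kappas_ge_1 D_pos s by (intro mult_right_mono) auto
  finally show "norm (y - xstar) \<le> 4 * \<kappa>A\<^sup>2 * \<kappa>f * (D * s ^ Suc k)" .
  have "norm (lam_prox ell l' (A *v y - b) - ls) \<le> norm ((A *v y - b) - (A *v xs - b)) / ell"
    unfolding ls_def by (rule lam_prox_lipschitz[OF ell_pos])
  also have "(A *v y - b) - (A *v xs - b) = A *v (y - xs)" by (simp add: matrix_vector_mult_diff_distrib)
  also have "norm (A *v (y - xs)) / ell \<le> LA * (s ^ Suc k * D) / ell"
    using order_trans[OF norm_matrix_vector_le[OF A_norm] mult_left_mono[OF y]] LA_pos ell_pos
    by (intro divide_right_mono) auto
  also have "\<dots> = (LA / ell * D) * s ^ Suc k" by simp
  also have "\<dots> = 5 / 12 * q * C * s ^ Suc k" unfolding C_eq(2) ..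
  \<comment> \<open>One factor \<open>s\<close> is given away so that both errors carry
    \<open>C * s ^ k\<close> and \<open>contraction\<close> applies.\<close>
  also have "\<dots> \<le> 5 / 12 * q * C * s ^ k"
    using q C_pos s by (intro mult_left_mono power_decreasing) auto
  finally have "norm (lam_prox ell l' (A *v y - b) - lamstar)
      \<le> 5 / 12 * q * C * s ^ k + 1 / (1 + q) * (C * s ^ k)"
    using inner_target(1)[OF lam xs] norm_triangle_ineq[of "lam_prox ell l' (A *v y - b) - ls" "ls - lamstar"]
    by (simp add: ls_def)
  also have "\<dots> = (5 / 12 * q + 1 / (1 + q)) * (C * s ^ k)" by (simp add: distrib_right)
  also have "\<dots> \<le> s * (C * s ^ k)"
    using contraction C_pos s by (intro mult_right_mono) auto
  finally show "norm (lam_prox ell l' (A *v y - b) - lamstar) \<le> C * s ^ Suc k" by (simp add: mult_ac)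
qed

lemma outer_invariant:
  "norm (lamk k - lamstar) \<le> C * s ^ k \<and> norm (xk k - xstar) \<le> 4 * \<kappa>A\<^sup>2 * \<kappa>f * (D * s ^ k)"
proof (induction k)
  case 0
  \<comment> \<open>The dual weight in \<open>D_star\<close> gives the initial bound
    \<open>D * Lf / LA\<close>, which is below \<open>C\<close> because
    \<open>\<mu>A \<le> LA\<close>.\<close>
  have "LA / Lf * norm (lam0 - lamstar) \<le> D" using D_star norm_ge_zero[of "x0 - xstar"] by linarith
  then have "norm (lam0 - lamstar) \<le> D * Lf / LA" using LA_pos f.L_pos by (simp add: field_simps)
  also have "\<dots> \<le> C"
  proof -
    have "\<mu>A\<^sup>2 \<le> LA\<^sup>2" using mu_A mu_A_le by (intro power_mono) auto
    then have "5 * \<mu>A\<^sup>2 \<le> 12 * LA\<^sup>2" using zero_le_power2[of LA] by linarith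
    then have "D * Lf * (5 * \<mu>A\<^sup>2) \<le> D * Lf * (12 * LA\<^sup>2)"
      using D_pos f.L_pos by (intro mult_left_mono) auto
    then show ?thesis
      using LA_pos mu_A f.L_pos by (simp add: C_def mu_Phi_def field_simps power2_eq_square)
  qed
  finally have "norm (lam0 - lamstar) \<le> C" .
  moreover have "0 \<le> LA / Lf * norm (lam0 - lamstar)" using LA_pos f.L_pos by simp
  then have "norm (x0 - xstar) \<le> D" using D_star by linarith
  then have "norm (x0 - xstar) \<le> 4 * \<kappa>A\<^sup>2 * \<kappa>f * D"
    using mult_right_mono[of 1 "4 * \<kappa>A\<^sup>2 * \<kappa>f" D] kappas_ge_1 D_pos by linarith
  ultimately show ?case by (simp add: ppa_x_def ppa_lam_def)
next
  case (Suc k)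
  \<comment> \<open>The output is defined through \<open>LEAST\<close>, so halting has to be known
    before anything can be said about the next iterate.\<close>
  have halts: "agd_halts (Psi ell (lamk k)) (ppa_L Lf LA ell) \<mu>f (xk k) (\<delta> (Suc k))"
    using inner_stop[of "lamk k" k "xk k"] Suc unfolding agd_halts_def by blast
  have x: "xk (Suc k) = agd_out (Psi ell (lamk k)) (ppa_L Lf LA ell) \<mu>f (xk k) (\<delta> (Suc k))"
    by (simp add: ppa_x_def ppa_lam_def Let_def split: prod.split)
  then have "lamk (Suc k) = lam_prox ell (lamk k) (A *v xk (Suc k) - b)"
    by (simp add: ppa_x_def ppa_lam_def lam_prox_def Let_def split: prod.split)
  then show ?case using inner_output[OF _ halts] Suc unfolding x by simp
qed

lemma outer_stop:
  "agd_stop (Psi ell (lamk k)) (ppa_L Lf LA ell) \<mu>f (xk k) (\<delta> (Suc k)) N"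
  using inner_stop outer_invariant by blast

lemma halts: "ppa_halts f h A b Lf \<mu>f LA \<mu>A ell D x0 lam0 T"
  unfolding ppa_halts_def
proof
  fix k assume "k \<in> {1..T}"
  then show "agd_halts (Psi ell (lamk (k - 1))) (ppa_L Lf LA ell) \<mu>f (xk (k - 1)) (\<delta> k)"
    using outer_stop[of "k - 1"] unfolding agd_halts_def by auto
qed

lemma grad_evals_le: "ppa_grad_evals f h A b Lf \<mu>f LA \<mu>A ell D x0 lam0 T \<le> T * (2 * N + 1)"
proof -
  have "agd_grad_evals (Psi ell (lamk (k - 1))) (ppa_L Lf LA ell) \<mu>f (xk (k - 1)) (\<delta> k) \<le> 2 * N + 1"
    if "k \<in> {1..T}" for k
    using outer_stop[of "k - 1"] that unfolding agd_grad_evals_def agd_steps_def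
    by (auto intro: Least_le)
  from sum_bounded_above[of "{1..T}", OF this] show ?thesis unfolding ppa_grad_evals_def by simp
qed

section \<open>Counting gradient evaluations\<close>

definition \<Lambda> :: real where "\<Lambda> = ln (2 + (\<kappa>f + \<kappa>A + D))"

text \<open>Allows additive constants to be absorbed into multiples of
  \<open>\<Lambda>\<close>.\<close>

lemma Lambda_ge_1: "1 \<le> \<Lambda>"
proof -
  have "exp 1 \<le> 2 + (\<kappa>f + \<kappa>A + D)" using exp_le kappas D_pos by linarith
  then show ?thesis unfolding \<Lambda>_def using kappas D_pos by (subst ln_ge_iff) auto
qed

lemma ln_le_Lambda:
  assumes "0 < x" "x \<le> (2 + (\<kappa>f + \<kappa>A + D)) ^ n"
  shows "ln x \<le> n * \<Lambda>"
proof -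
  have "ln x \<le> ln ((2 + (\<kappa>f + \<kappa>A + D)) ^ n)" using assms by simp
  then show ?thesis using kappas D_pos by (simp add: \<Lambda>_def ln_realpow)
qed

text \<open>The lower bound on \<open>ell\<close> keeps the smoothing term
  \<open>LA\<^sup>2 / ell\<close> below \<open>\<kappa>A\<^sup>2 * Lf\<close>.\<close>

lemma kappa_le: "\<kappa> \<le> 2 * \<kappa>A\<^sup>2 * \<kappa>f" "1 \<le> \<kappa>"
proof -
  have "LA\<^sup>2 / ell \<le> LA\<^sup>2 / mu_Phi Lf \<mu>A"
    using ell_ge mu_Phi_pos by (intro divide_left_mono) (auto simp: ell_pos)
  also have "\<dots> = \<kappa>A\<^sup>2 * Lf" by (simp add: mu_Phi_def \<kappa>A_def power_divide)
  moreover have "Lf \<le> \<kappa>A\<^sup>2 * Lf" using kappas f.L_pos by simp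
  ultimately have "ppa_L Lf LA ell \<le> 2 * \<kappa>A\<^sup>2 * Lf" unfolding ppa_L_def by linarith
  then show "\<kappa> \<le> 2 * \<kappa>A\<^sup>2 * \<kappa>f"
    unfolding \<kappa>_def \<kappa>f_def using mu_f by (simp add: divide_right_mono)
  have "\<mu>f \<le> ppa_L Lf LA ell" using f.mu_le_L ell_pos by (simp add: ppa_L_def add_increasing2)
  then show "1 \<le> \<kappa>" using mu_f by (simp add: \<kappa>_def)
qed

lemma inner_count: "2 * real N + 1 \<le> 54 * (\<kappa>A * sqrt \<kappa>f * \<Lambda>)"
proof -
  define B where "B = 2 + (\<kappa>f + \<kappa>A + D)"
  define Z where "Z = \<kappa>A * sqrt \<kappa>f * \<Lambda>"
  have Z: "1 \<le> Z"
    unfolding Z_def using kappas Lambda_ge_1 mult_mono[of 1 "\<kappa>A" 1 "sqrt \<kappa>f"]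
      mult_mono[of 1 "\<kappa>A * sqrt \<kappa>f" 1 \<Lambda>] by simp
  have B: "4 \<le> B" "\<kappa>f \<le> B" "\<kappa>A \<le> B" using kappas D_pos by (auto simp: B_def)
  have "2 * \<kappa>\<^sup>2 * (9 * \<kappa>A\<^sup>2 * \<kappa>f)\<^sup>2 \<le> 2 * (2 * \<kappa>A\<^sup>2 * \<kappa>f)\<^sup>2 * (9 * \<kappa>A\<^sup>2 * \<kappa>f)\<^sup>2"
    using kappa_le kappas by (intro mult_mono power_mono) auto
  also have "\<dots> = 648 * (\<kappa>A ^ 8 * \<kappa>f ^ 4)" by algebra
  \<comment> \<open>The numeral is absorbed by powers of \<open>B \<ge> 4\<close>, so that the
    logarithm is a pure multiple of \<open>\<Lambda>\<close>.\<close>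
  also have "\<dots> \<le> B ^ 5 * (B ^ 8 * B ^ 4)"
  proof -
    have "(648 :: real) \<le> 4 ^ 5" by simp
    also have "\<dots> \<le> B ^ 5" using B by (intro power_mono) auto
    finally show ?thesis using B kappas by (intro mult_mono power_mono) auto
  qed
  also have "\<dots> = B ^ 17" by (simp flip: power_add)
  finally have "ln (2 * \<kappa>\<^sup>2 * (9 * \<kappa>A\<^sup>2 * \<kappa>f)\<^sup>2) \<le> 17 * \<Lambda>"
    using ln_le_Lambda[of _ 17] kappas kappa_le by (simp add: B_def)
  \<comment> \<open>\<open>3 / 2\<close> is a rational upper bound for the square root of
    \<open>2\<close>.\<close>
  moreover have "sqrt \<kappa> \<le> 3 / 2 * (\<kappa>A * sqrt \<kappa>f)"
  proof (rule real_le_lsqrt)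
    have "2 * \<kappa>A\<^sup>2 * \<kappa>f \<le> 9 / 4 * (\<kappa>A\<^sup>2 * \<kappa>f)" using kappas_ge_1 by linarith
    moreover have "(3 / 2 * (\<kappa>A * sqrt \<kappa>f))\<^sup>2 = 9 / 4 * (\<kappa>A\<^sup>2 * \<kappa>f)"
      using kappas by (simp add: power_mult_distrib power_divide)
    ultimately show "\<kappa> \<le> (3 / 2 * (\<kappa>A * sqrt \<kappa>f))\<^sup>2" using kappa_le(1) by linarith
  qed (use kappas kappa_le in auto)
  ultimately have "sqrt \<kappa> * ln (2 * \<kappa>\<^sup>2 * (9 * \<kappa>A\<^sup>2 * \<kappa>f)\<^sup>2) \<le> (3 / 2 * (\<kappa>A * sqrt \<kappa>f)) * (17 * \<Lambda>)"
    using kappas kappa_le Lambda_ge_1 mult_mono[of 1 "\<kappa>\<^sup>2" 1 "(9 * \<kappa>A\<^sup>2 * \<kappa>f)\<^sup>2"]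
      one_le_power[of "9 * \<kappa>A\<^sup>2 * \<kappa>f" 2] one_le_power[of \<kappa> 2] kappas_ge_1
    by (intro mult_mono) auto
  also have "\<dots> = 51 / 2 * Z" by (simp add: Z_def)
  finally have "real N \<le> 51 / 2 * Z + 1"
    using Z unfolding N_def by linarith
  then show ?thesis using Z unfolding Z_def[symmetric] by linarith
qed

text \<open>\<open>T\<close> is the least count for which \<open>exp (- (q / 12 * T))\<close>, an
  upper bound for \<open>s\<^sup>2\<close> to the power \<open>T\<close>, brings the squared
  invariant below \<open>\<epsilon>\<close>.\<close>

lemma outer_count:
  assumes eps: "0 < \<epsilon>"
  defines "T \<equiv> nat \<lceil>12 / q * ln ((4 * \<kappa>A\<^sup>2 * \<kappa>f * D)\<^sup>2 / \<epsilon>)\<rceil>"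
  shows "subopt_SC xstar (xk T) \<le> \<epsilon>"
    and "real T \<le> 121 * (\<Lambda> * max 1 (ln (D / \<epsilon>)) / q)"
proof -
  define K where "K = 4 * \<kappa>A\<^sup>2 * \<kappa>f * D"
  have K: "0 < K" unfolding K_def using kappas D_pos by (intro mult_pos_pos) auto
  have "12 / q * ln (K\<^sup>2 / \<epsilon>) \<le> T" unfolding T_def K_def by linarith
  then have T: "ln (K\<^sup>2 / \<epsilon>) \<le> q / 12 * T" using q by (simp add: field_simps)
  have "subopt_SC xstar (xk T) \<le> (K * s ^ T)\<^sup>2"
    unfolding subopt_SC_def using outer_invariant[of T] by (intro power_mono) (auto simp: K_def mult_ac)
  also have "\<dots> = K\<^sup>2 * (1 - q / 12) ^ T"
    by (simp add: power_mult_distrib flip: s(5) power_mult) (simp add: mult.commute)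
  also have "\<dots> \<le> K\<^sup>2 * exp (- (q / 12)) ^ T"
    using q exp_ge_add_one_self[of "- (q / 12)"] by (intro mult_left_mono power_mono) auto
  also have "exp (- (q / 12)) ^ T = exp (- (q / 12 * T))"
    using exp_of_nat2_mult[of "- (q / 12)" T] by simp
  also have "\<dots> \<le> exp (- ln (K\<^sup>2 / \<epsilon>))" using T by simp
  also have "\<dots> = \<epsilon> / K\<^sup>2" using K eps by (simp add: exp_minus)
  finally show "subopt_SC xstar (xk T) \<le> \<epsilon>" using K by simp

  define B where "B = 2 + (\<kappa>f + \<kappa>A + D)"
  define M where "M = max 1 (ln (D / \<epsilon>))"
  have M: "1 \<le> M" "ln (D / \<epsilon>) \<le> M" by (auto simp: M_def)
  have B: "4 \<le> B" "\<kappa>f \<le> B" "\<kappa>A \<le> B" "D \<le> B" using kappas D_pos by (auto simp: B_def)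
  have "(4 * \<kappa>A\<^sup>2 * \<kappa>f)\<^sup>2 * D = 4\<^sup>2 * (\<kappa>A ^ 4 * \<kappa>f\<^sup>2 * D)"
    by (simp add: power_mult_distrib flip: power_mult)
  also have "\<dots> \<le> B\<^sup>2 * (B ^ 4 * B\<^sup>2 * B)"
    using B kappas D_pos by (intro mult_mono power_mono) auto
  also have "\<dots> = B ^ 9" by (simp flip: power_add power_Suc2)
  finally have "ln ((4 * \<kappa>A\<^sup>2 * \<kappa>f)\<^sup>2 * D) \<le> 9 * \<Lambda>"
    using ln_le_Lambda[of _ 9] kappas D_pos by (simp add: B_def)
  \<comment> \<open>One of the two factors \<open>D\<close> in \<open>K\<^sup>2\<close> is paired
    with \<open>\<epsilon>\<close>; the other goes into \<open>\<Lambda>\<close>.\<close>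
  moreover have "ln (K\<^sup>2 / \<epsilon>) = ln ((4 * \<kappa>A\<^sup>2 * \<kappa>f)\<^sup>2 * D) + ln (D / \<epsilon>)"
  proof -
    have "K\<^sup>2 / \<epsilon> = ((4 * \<kappa>A\<^sup>2 * \<kappa>f)\<^sup>2 * D) * (D / \<epsilon>)" by (simp add: K_def power_mult_distrib power2_eq_square)
    then have "ln (K\<^sup>2 / \<epsilon>) = ln (((4 * \<kappa>A\<^sup>2 * \<kappa>f)\<^sup>2 * D) * (D / \<epsilon>))" by (rule arg_cong)
    also have "\<dots> = ln ((4 * \<kappa>A\<^sup>2 * \<kappa>f)\<^sup>2 * D) + ln (D / \<epsilon>)"
      using kappas D_pos eps by (intro ln_mult_pos mult_pos_pos) auto
    finally show ?thesis .
  qed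
  ultimately have "ln (K\<^sup>2 / \<epsilon>) \<le> 9 * \<Lambda> + M" using M by linarith
  also have "\<dots> \<le> 9 * (\<Lambda> * M) + \<Lambda> * M"
    using M Lambda_ge_1 mult_left_mono[of 1 M \<Lambda>] mult_right_mono[of 1 \<Lambda> M] by (intro add_mono) auto
  finally have "ln (K\<^sup>2 / \<epsilon>) \<le> 10 * (\<Lambda> * M)" by linarith
  then have "12 / q * ln (K\<^sup>2 / \<epsilon>) \<le> 12 / q * (10 * (\<Lambda> * M))"
    using q by (intro mult_left_mono) auto
  then have "12 / q * ln (K\<^sup>2 / \<epsilon>) \<le> 120 * (\<Lambda> * M / q)" by simp
  \<comment> \<open>Pays for rounding up, hence \<open>121\<close> instead of
    \<open>120\<close>.\<close>
  moreover have "1 \<le> \<Lambda> * M / q"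
    using q M Lambda_ge_1 mult_mono[of 1 \<Lambda> 1 M] by (simp add: field_simps)
  ultimately show "real T \<le> 121 * (\<Lambda> * max 1 (ln (D / \<epsilon>)) / q)"
    unfolding T_def K_def M_def[symmetric] by linarith
qed

text \<open>The outer and the inner count contribute one factor \<open>\<Lambda>\<close> each, hence
  the square in \<open>soft_O\<close>; the constant is \<open>121 * 54 = 6534\<close>.\<close>

lemma complexity:
  assumes eps: "0 < \<epsilon>"
  shows "\<exists>T. ppa_halts f h A b Lf \<mu>f LA \<mu>A ell D x0 lam0 T
    \<and> subopt_SC xstar (xk T) \<le> \<epsilon>
    \<and> real (ppa_grad_evals f h A b Lf \<mu>f LA \<mu>A ell D x0 lam0 T)
        \<le> soft_O (Lf / \<mu>f + LA / \<mu>A + D)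
            (ell / mu_Phi Lf \<mu>A * (LA / \<mu>A * sqrt (Lf / \<mu>f) * max 1 (ln (D / \<epsilon>))))"
proof -
  define M where "M = max 1 (ln (D / \<epsilon>))"
  obtain T where T: "subopt_SC xstar (xk T) \<le> \<epsilon>" "real T \<le> 121 * (\<Lambda> * M / q)"
    using outer_count[OF eps] unfolding M_def by blast
  have nn: "0 \<le> \<Lambda> * M / q" "0 \<le> \<Lambda>\<^sup>2 * (1 / q * (\<kappa>A * sqrt \<kappa>f * M))"
    using Lambda_ge_1 q kappas by (auto simp: M_def)
  have "real (ppa_grad_evals f h A b Lf \<mu>f LA \<mu>A ell D x0 lam0 T) \<le> real (T * (2 * N + 1))"
    using grad_evals_le by (rule of_nat_mono)
  also have "\<dots> = real T * (2 * real N + 1)" by (simp add: algebra_simps)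
  also have "\<dots> \<le> (121 * (\<Lambda> * M / q)) * (54 * (\<kappa>A * sqrt \<kappa>f * \<Lambda>))"
    using T(2) inner_count nn by (intro mult_mono) auto
  also have "\<dots> = 6534 * (\<Lambda>\<^sup>2 * (1 / q * (\<kappa>A * sqrt \<kappa>f * M)))" by (simp add: power2_eq_square)
  also have "\<dots> \<le> 10 ^ 5 * (\<Lambda>\<^sup>2 * (1 / q * (\<kappa>A * sqrt \<kappa>f * M)))"
    using nn by (intro mult_right_mono) auto
  also have "\<dots> = soft_O (Lf / \<mu>f + LA / \<mu>A + D)
      (ell / mu_Phi Lf \<mu>A * (LA / \<mu>A * sqrt (Lf / \<mu>f) * M))"
    by (simp add: soft_O_def \<Lambda>_def q_def \<kappa>A_def \<kappa>f_def)
  finally show ?thesis using T(1) halts unfolding M_def by blast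
qed

end

text \<open>The factor \<open>ell / mu_Phi Lf \<mu>A\<close> is the \<open>1 / q\<close> of the
  outer count and equals \<open>1\<close> for the smallest admissible \<open>ell\<close>;
  \<open>max 1\<close> covers accuracies near or above \<open>D\<close>, where the logarithm is
  small or negative.\<close>

theorem corollary1:
  fixes f :: "real^'n \<Rightarrow> real" and h :: "real^'m \<Rightarrow> ereal"
    and A :: "real^'n^'m" and b :: "real^'m"
    and Lf \<mu>f LA \<mu>A ell D \<epsilon> :: real
    and x0 xstar :: "real^'n" and lam0 lamstar :: "real^'m"
  assumes f_smooth: "smooth_fun Lf f"
    and f_sc: "\<mu>f > 0" "strongly_convex \<mu>f f"
    and h_pcc: "proper_closed_convex h"
    and A_rank: "rank A = CARD('m)"
    and A_norm: "onorm ((*v) A) \<le> LA"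
    and A_sing: "\<mu>A > 0" "min_singular_value A \<ge> \<mu>A"
    and primal_opt: "\<forall>x. primal_obj f h A b xstar \<le> primal_obj f h A b x"
    and dual_opt: "\<forall>lam. dual_obj f h A b lam \<le> dual_obj f h A b lamstar"
    and ell: "ell \<ge> mu_Phi Lf \<mu>A"
    and D_pos: "D > 0"
    and D_star: "norm (x0 - xstar) + LA / Lf * norm (lam0 - lamstar) \<le> D"
    and eps: "\<epsilon> > 0"
  shows "\<exists>T. ppa_halts f h A b Lf \<mu>f LA \<mu>A ell D x0 lam0 T
    \<and> subopt_SC xstar (ppa_x f h A b Lf \<mu>f LA \<mu>A ell D x0 lam0 T) \<le> \<epsilon>
    \<and> real (ppa_grad_evals f h A b Lf \<mu>f LA \<mu>A ell D x0 lam0 T)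
        \<le> soft_O (Lf / \<mu>f + LA / \<mu>A + D)
            (ell / mu_Phi Lf \<mu>A * (LA / \<mu>A * sqrt (Lf / \<mu>f) * max 1 (ln (D / \<epsilon>))))"
proof -
  interpret inexact_ppa f h A b Lf \<mu>f LA \<mu>A xstar lamstar ell D x0 lam0
    using assms by unfold_locales auto
  show ?thesis by (rule complexity[OF eps])
qed

end
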